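(* Let $T=(V,E)$ be a finite rooted tree with $n$ vertices and let $b\in[0,1)$. Suppose $C=C(T,b)\ge0$ is a real number such that for every Polish metric space $\mathscr{H}$ of diameter at most $1$ and every $b$-Lipschitz $\mathscr{H}$-valued Markov measure $\nu$ indexed by $T$ we have \[\int e^{n\lambda f}\,d\nu\le e^{C^2\lambda^2/8}\] for all $\lambda\in\mathbb{R}$ and all $f\colon\mathscr{H}^V\to\mathbb{R}$ that are $1$-Lipschitz for the normalized Hamming metric with $\int f\,d\nu=0$, or equivalently \[\bar d(\mu,\nu)\le\frac{C}{n}\sqrt{\tfrac12D(\mu\|\nu)}\] for all $\mu\in\mathrm{Prob}(\mathscr{H}^V)$. Then \[C\ge\Delta\,\frac{\sqrt{1-b^2}}{2},\] where $\Delta=\Delta(T,b)$ is the $\ell^2(V)$-norm of the descendant generating function of $T$.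
   Context: $\mathrm{Prob}(X)$ is the set of Borel probability measures on $X$. For a finite set $V$, the normalized Hamming metric on $\mathscr{H}^V$ is $d(x,y)=\frac1{|V|}\sum_{v\in V}d(x_v,y_v)$. The transportation metric on $\mathrm{Prob}(\mathscr{H}^V)$ is $\bar d(\mu,\nu)=\inf_\lambda\int d(x,y)\,d\lambda(x,y)$, the infimum being over couplings $\lambda$ of $\mu$ and $\nu$; $\bar d$ on $\mathrm{Prob}(\mathscr{H})$ is the case $|V|=1$. Relative entropy: $D(\mu\|\nu)=\int\log\frac{d\mu}{d\nu}\,d\mu$ if $\mu\ll\nu$, and $+\infty$ otherwise. Trees: $T$ has root $\rho$; $\pi(v)$ is the parent of a non-root vertex $v$; $d(v,w)$ is the graph distance; $v\le w$ means that $v$ lies on the simple path from $\rho$ to $w$ (endpoints included); $D_r(v)=\{w\in V: v\le w,\ d(v,w)=r\}$. Markov measure indexed by $T$: let $r$ be the depth of $T$ and $L_k$ the set of vertices at distance $k$ from $\rho$. Given $\nu_\rho\in\mathrm{Prob}(\mathscr{H})$ and probability kernels $q_v\colon\mathscr{H}\to\mathrm{Prob}(\mathscr{H})$ for $v\in V\setminus\{\rho\}$, the associated Markov measure is the $\nu\in\mathrm{Prob}(\mathscr{H}^V)$ given by \[\nu(A)=\int_{\mathscr{H}^{L_0}}\int_{\mathscr{H}^{L_1}}\cdots\int_{\mathscr{H}^{L_r}}\mathbf 1_A(y)\prod_{v\in L_r}q_v(dy_v|y_{\pi(v)})\cdots\prod_{v\in L_1}q_v(dy_v|y_\rho)\,\nu_\rho(dy_\rho)\]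 for Borel $A\subseteq\mathscr{H}^V$. It is $b$-Lipschitz if each $q_v$ is $b$-Lipschitz as a map $(\mathscr{H},d)\to(\mathrm{Prob}(\mathscr{H}),\bar d)$. Descendant generating function: $\delta(v)=\sum_{r=0}^\infty|D_r(v)|\,b^r$ for $v\in V$ (with $b^0=1$, also when $b=0$), and $\Delta=\big(\sum_{v\in V}\delta(v)^2\big)^{1/2}$. *)

theory Defs
  imports "HOL-Probability.Probability"
begin

section \<open>Finite rooted trees\<close>

definition simple_path :: "'v set \<Rightarrow> 'v set set \<Rightarrow> 'v \<Rightarrow> 'v list \<Rightarrow> 'v \<Rightarrow> bool" where
  "simple_path V E u p v \<longleftrightarrow>
     p \<noteq> [] \<and> set p \<subseteq> V \<and> hd p = u \<and> last p = v \<and> distinct p \<and>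
     successively (\<lambda>x y. {x, y} \<in> E) p"

definition finite_rooted_tree :: "'v set \<Rightarrow> 'v set set \<Rightarrow> 'v \<Rightarrow> bool" where
  "finite_rooted_tree V E \<rho> \<longleftrightarrow>
     finite V \<and> \<rho> \<in> V \<and>
     (\<forall>e\<in>E. \<exists>x\<in>V. \<exists>y\<in>V. x \<noteq> y \<and> e = {x, y}) \<and>
     (\<forall>u\<in>V. \<forall>v\<in>V. \<exists>!p. simple_path V E u p v)"

definition tree_path :: "'v set \<Rightarrow> 'v set set \<Rightarrow> 'v \<Rightarrow> 'v \<Rightarrow> 'v list" where
  "tree_path V E u v = (THE p. simple_path V E u p v)"

text \<open>Length of a shortest path, counted in edges.\<close>

definition graph_dist :: "'v set \<Rightarrow> 'v set set \<Rightarrow> 'v \<Rightarrow> 'v \<Rightarrow> nat" where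
  "graph_dist V E u v = (LEAST k. \<exists>p. simple_path V E u p v \<and> length p = Suc k)"

text \<open>The last vertex before \<open>v\<close> on the path from the root; meaningful only for
  \<open>v \<noteq> \<rho>\<close>.\<close>

definition parent :: "'v set \<Rightarrow> 'v set set \<Rightarrow> 'v \<Rightarrow> 'v \<Rightarrow> 'v" where
  "parent V E \<rho> v = last (butlast (tree_path V E \<rho> v))"

definition tree_le :: "'v set \<Rightarrow> 'v set set \<Rightarrow> 'v \<Rightarrow> 'v \<Rightarrow> 'v \<Rightarrow> bool" where
  "tree_le V E \<rho> v w \<longleftrightarrow> v \<in> set (tree_path V E \<rho> w)"

definition level :: "'v set \<Rightarrow> 'v set set \<Rightarrow> 'v \<Rightarrow> nat \<Rightarrow> 'v set" where
  "level V E \<rho> k = {v \<in> V. graph_dist V E \<rho> v = k}"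

definition depth :: "'v set \<Rightarrow> 'v set set \<Rightarrow> 'v \<Rightarrow> nat" where
  "depth V E \<rho> = Max (graph_dist V E \<rho> ` V)"

definition descendants :: "'v set \<Rightarrow> 'v set set \<Rightarrow> 'v \<Rightarrow> nat \<Rightarrow> 'v \<Rightarrow> 'v set" where
  "descendants V E \<rho> r v = {w \<in> V. tree_le V E \<rho> v w \<and> graph_dist V E v w = r}"

definition desc_gen :: "'v set \<Rightarrow> 'v set set \<Rightarrow> 'v \<Rightarrow> real \<Rightarrow> 'v \<Rightarrow> real" where
  "desc_gen V E \<rho> b v = (\<Sum>r. real (card (descendants V E \<rho> r v)) * b ^ r)"

definition desc_gen_norm :: "'v set \<Rightarrow> 'v set set \<Rightarrow> 'v \<Rightarrow> real \<Rightarrow> real" where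
  "desc_gen_norm V E \<rho> b = sqrt (\<Sum>v\<in>V. (desc_gen V E \<rho> b v)\<^sup>2)"


section \<open>Metric spaces, measures and transportation\<close>

definition polish_metric :: "'a metric \<Rightarrow> bool" where
  "polish_metric M \<longleftrightarrow> mcomplete_of M \<and> separable_space (mtopology_of M)"

text \<open>
  A quantifier over all Polish metric spaces cannot range over types, so it is written as a
  quantifier over \<^typ>\<open>real metric\<close>: all metric spaces whose points form a set of reals, the
  metric on that set being arbitrary and unrelated to the usual distance. By the following
  lemma this loses nothing: every separable metric space is isometric to one of these.
\<close>

lemma separable_metric_isometric_real:
  fixes M :: "'a metric"
  assumes "separable_space (mtopology_of M)"
  obtains N :: "real metric" and g
  where "bij_betw g (mspace M) (mspace N)"
    and "\<And>x y. x \<in> mspace M \<Longrightarrow> y \<in> mspace M \<Longrightarrow> mdist N (g x) (g y) = mdist M x y"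
proof -
  interpret M: Metric_space "mspace M" "mdist M" by simp
  obtain D where D: "countable D" "D \<subseteq> mspace M" "mtopology_of M closure_of D = mspace M"
    using assms unfolding separable_space_def by auto
  define h :: "'a \<Rightarrow> nat set" where
    "h x = {k. case from_nat k of (n :: nat, q :: rat) \<Rightarrow>
              mdist M x (from_nat_into D n) < real_of_rat q}" for x
  have inj_h: "inj_on h (mspace M)"
  proof (rule inj_onI, rule ccontr)
    fix x y assume xy: "x \<in> mspace M" "y \<in> mspace M" "h x = h y" "x \<noteq> y"
    then have pos: "mdist M x y > 0" by simp
    have "x \<in> M.mtopology closure_of D"
      using D(3) xy by (simp add: mtopology_of_def)
    then obtain c where c: "c \<in> D" "c \<in> M.mball x (mdist M x y / 2)"
      using half_gt_zero[OF pos] unfolding M.metric_closure_of by blast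
    then have cM: "c \<in> mspace M" and less: "mdist M x c < mdist M x y / 2"
      by auto
    have "mdist M x y \<le> mdist M x c + mdist M c y"
      using M.triangle xy cM by blast
    then have "mdist M x c < mdist M y c"
      using less by (simp add: M.commute)
    then obtain q where q: "mdist M x c < real_of_rat q" "real_of_rat q < mdist M y c"
      using of_rat_dense by blast
    obtain n where n: "from_nat_into D n = c"
      using from_nat_into_surj[OF D(1) c(1)] by blast
    have "to_nat (n, q) \<in> h x" "to_nat (n, q) \<notin> h y"
      using q n by (auto simp: h_def)
    then show False using xy by simp
  qed
  obtain e :: "nat set \<Rightarrow> real" where e: "inj e"
    using nat_sets_eqpoll_reals unfolding eqpoll_def bij_betw_def by blast
  define g where "g = e \<circ> h"
  have inj_g: "inj_on g (mspace M)"
    unfolding g_def using inj_h e by (meson comp_inj_on inj_on_subset subset_UNIV)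
  define i where "i = inv_into (mspace M) g"
  interpret N: Metric_space "g ` mspace M" "\<lambda>a b. mdist M (i a) (i b)"
  proof
    fix a b c assume "a \<in> g ` mspace M" "b \<in> g ` mspace M"
    then show "mdist M (i a) (i b) = 0 \<longleftrightarrow> a = b"
      by (auto simp: i_def inj_g)
    assume "c \<in> g ` mspace M"
    with \<open>a \<in> g ` mspace M\<close> \<open>b \<in> g ` mspace M\<close>
    show "mdist M (i a) (i c) \<le> mdist M (i a) (i b) + mdist M (i b) (i c)"
      by (auto simp: i_def inj_g intro: M.triangle)
  qed (auto simp: mdist_commute)
  show thesis
  proof (rule that)
    show "bij_betw g (mspace M) (mspace (metric (g ` mspace M, \<lambda>a b. mdist M (i a) (i b))))"
      unfolding N.mspace_metric using inj_g by (simp add: bij_betw_def)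
    show "mdist (metric (g ` mspace M, \<lambda>a b. mdist M (i a) (i b))) (g x) (g y) = mdist M x y"
      if "x \<in> mspace M" "y \<in> mspace M" for x y
      unfolding N.mdist_metric using that inj_g by (simp add: i_def)
  qed
qed

definition hamming_metric :: "'v set \<Rightarrow> 'a metric \<Rightarrow> ('v \<Rightarrow> 'a) metric" where
  "hamming_metric V M =
     metric (V \<rightarrow>\<^sub>E mspace M, \<lambda>x y. (\<Sum>v\<in>V. mdist M (x v) (y v)) / real (card V))"

lemma Metric_space_hamming:
  assumes "finite V"
  shows "Metric_space (V \<rightarrow>\<^sub>E mspace M) (\<lambda>x y. (\<Sum>v\<in>V. mdist M (x v) (y v)) / real (card V))"
proof
  fix x y z :: "'a \<Rightarrow> 'b"
  show "0 \<le> (\<Sum>v\<in>V. mdist M (x v) (y v)) / real (card V)"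
    by (simp add: sum_nonneg)
  show "(\<Sum>v\<in>V. mdist M (x v) (y v)) / real (card V)
      = (\<Sum>v\<in>V. mdist M (y v) (x v)) / real (card V)"
    by (simp add: mdist_commute)
  assume x: "x \<in> V \<rightarrow>\<^sub>E mspace M" and y: "y \<in> V \<rightarrow>\<^sub>E mspace M"
  have "(\<Sum>v\<in>V. mdist M (x v) (y v)) / real (card V) = 0 \<longleftrightarrow> (\<forall>v\<in>V. mdist M (x v) (y v) = 0)"
    using assms by (auto simp: sum_nonneg_eq_0_iff)
  also have "\<dots> \<longleftrightarrow> (\<forall>v\<in>V. x v = y v)"
    using x y by (metis PiE_mem mdist_zero)
  also have "\<dots> \<longleftrightarrow> x = y"
    using x y by (auto intro: PiE_ext)
  finally show "(\<Sum>v\<in>V. mdist M (x v) (y v)) / real (card V) = 0 \<longleftrightarrow> x = y" .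
  assume z: "z \<in> V \<rightarrow>\<^sub>E mspace M"
  have "mdist M (x v) (z v) \<le> mdist M (x v) (y v) + mdist M (y v) (z v)" if "v \<in> V" for v
    using x y z that by (intro mdist_triangle) auto
  then show "(\<Sum>v\<in>V. mdist M (x v) (z v)) / real (card V)
      \<le> (\<Sum>v\<in>V. mdist M (x v) (y v)) / real (card V) + (\<Sum>v\<in>V. mdist M (y v) (z v)) / real (card V)"
    by (simp add: divide_right_mono sum_mono flip: add_divide_distrib sum.distrib)
qed

lemma mspace_hamming [simp]: "finite V \<Longrightarrow> mspace (hamming_metric V M) = (V \<rightarrow>\<^sub>E mspace M)"
  unfolding hamming_metric_def by (rule Metric_space.mspace_metric[OF Metric_space_hamming])

lemma mdist_hamming [simp]:
  "finite V \<Longrightarrow>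
     mdist (hamming_metric V M) x y = (\<Sum>v\<in>V. mdist M (x v) (y v)) / real (card V)"
  unfolding hamming_metric_def by (simp add: Metric_space.mdist_metric[OF Metric_space_hamming])

definition metric_borel :: "'a metric \<Rightarrow> 'a measure" where
  "metric_borel M = sigma (mspace M) {U. openin (mtopology_of M) U}"

definition Prob :: "'a metric \<Rightarrow> 'a measure set" where
  "Prob M = space (prob_algebra (metric_borel M))"

text \<open>For separable \<open>M\<close> the product of the Borel sigma-algebras is the Borel sigma-algebra of
  the product space, so these are the usual couplings.\<close>

definition couplings :: "'a metric \<Rightarrow> 'a measure \<Rightarrow> 'a measure \<Rightarrow> ('a \<times> 'a) measure set" where
  "couplings M \<mu> \<nu> =
     {\<kappa> \<in> space (prob_algebra (metric_borel M \<Otimes>\<^sub>M metric_borel M)).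
        distr \<kappa> (metric_borel M) fst = \<mu> \<and> distr \<kappa> (metric_borel M) snd = \<nu>}"

definition transport_dist :: "'a metric \<Rightarrow> 'a measure \<Rightarrow> 'a measure \<Rightarrow> real" where
  "transport_dist M \<mu> \<nu> = (INF \<kappa>\<in>couplings M \<mu> \<nu>. \<integral>z. mdist M (fst z) (snd z) \<partial>\<kappa>)"

text \<open>\<open>D(\<mu> \<parallel> \<nu>)\<close>, to the natural base. The negative part of \<open>log (d\<mu>/d\<nu>)\<close> is always
  \<open>\<mu>\<close>-integrable, so the integral is \<open>\<infinity>\<close> whenever the integrand fails to be integrable.\<close>

definition relative_entropy :: "'a measure \<Rightarrow> 'a measure \<Rightarrow> ereal" where
  "relative_entropy \<mu> \<nu> =
     (if absolutely_continuous \<nu> \<mu> \<and> integrable \<mu> (entropy_density (exp 1) \<nu> \<mu>)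
      then ereal (KL_divergence (exp 1) \<nu> \<mu>) else \<infinity>)"


section \<open>Markov measures indexed by a tree\<close>

text \<open>
  Given the values \<open>y\<close> on levels \<open>0, \<dots>, k - 1\<close>, integrate \<open>F\<close> over the next \<open>m\<close> levels
  \<open>k, \<dots>, k + m - 1\<close>, the innermost integral being over the deepest one.
\<close>

primrec level_integral ::
  "'v set \<Rightarrow> 'v set set \<Rightarrow> 'v \<Rightarrow> ('v \<Rightarrow> 'a \<Rightarrow> 'a measure) \<Rightarrow> (('v \<Rightarrow> 'a) \<Rightarrow> ennreal)
     \<Rightarrow> nat \<Rightarrow> nat \<Rightarrow> ('v \<Rightarrow> 'a) \<Rightarrow> ennreal" where
  "level_integral V E \<rho> q F 0 k y = F y"
| "level_integral V E \<rho> q F (Suc m) k y =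
     (\<integral>\<^sup>+ z. level_integral V E \<rho> q F m (Suc k)
               (merge (\<Union>j<k. level V E \<rho> j) (level V E \<rho> k) (y, z))
        \<partial>(\<Pi>\<^sub>M v\<in>level V E \<rho> k. q v (y (parent V E \<rho> v))))"

definition markov_measure ::
  "'v set \<Rightarrow> 'v set set \<Rightarrow> 'v \<Rightarrow> 'a metric \<Rightarrow> 'a measure \<Rightarrow> ('v \<Rightarrow> 'a \<Rightarrow> 'a measure)
     \<Rightarrow> ('v \<Rightarrow> 'a) measure \<Rightarrow> bool" where
  "markov_measure V E \<rho> M \<nu>\<^sub>0 q \<nu> \<longleftrightarrow>
     \<nu>\<^sub>0 \<in> Prob M \<and>
     (\<forall>v\<in>V - {\<rho>}. q v \<in> metric_borel M \<rightarrow>\<^sub>M prob_algebra (metric_borel M)) \<and>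
     \<nu> \<in> Prob (hamming_metric V M) \<and>
     (\<forall>A\<in>sets (metric_borel (hamming_metric V M)).
        emeasure \<nu> A =
          (\<integral>\<^sup>+ x. level_integral V E \<rho> q (indicator A) (depth V E \<rho>) 1 (\<lambda>v\<in>{\<rho>}. x) \<partial>\<nu>\<^sub>0))"

definition lipschitz_kernel :: "'a metric \<Rightarrow> real \<Rightarrow> ('a \<Rightarrow> 'a measure) \<Rightarrow> bool" where
  "lipschitz_kernel M b \<kappa> \<longleftrightarrow>
     (\<forall>x\<in>mspace M. \<forall>y\<in>mspace M. transport_dist M (\<kappa> x) (\<kappa> y) \<le> b * mdist M x y)"

definition lipschitz_markov_measure ::
  "'v set \<Rightarrow> 'v set set \<Rightarrow> 'v \<Rightarrow> real \<Rightarrow> 'a metric \<Rightarrow> ('v \<Rightarrow> 'a) measure \<Rightarrow> bool" where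
  "lipschitz_markov_measure V E \<rho> b M \<nu> \<longleftrightarrow>
     (\<exists>\<nu>\<^sub>0 q. markov_measure V E \<rho> M \<nu>\<^sub>0 q \<nu> \<and> (\<forall>v\<in>V - {\<rho>}. lipschitz_kernel M b (q v)))"


section \<open>The two forms of the concentration inequality\<close>

definition lipschitz1 :: "'a metric \<Rightarrow> ('a \<Rightarrow> real) \<Rightarrow> bool" where
  "lipschitz1 M f \<longleftrightarrow> (\<forall>x\<in>mspace M. \<forall>y\<in>mspace M. \<bar>f x - f y\<bar> \<le> mdist M x y)"

definition exponential_moment_bound :: "'v set \<Rightarrow> 'a metric \<Rightarrow> real \<Rightarrow> ('v \<Rightarrow> 'a) measure \<Rightarrow> bool"
  where
  "exponential_moment_bound V M C \<nu> \<longleftrightarrow>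
     (\<forall>t f. lipschitz1 (hamming_metric V M) f \<and> (\<integral>x. f x \<partial>\<nu>) = 0 \<longrightarrow>
        (\<integral>x. exp (real (card V) * t * f x) \<partial>\<nu>) \<le> exp (C\<^sup>2 * t\<^sup>2 / 8))"

text \<open>If \<open>D(\<mu> \<parallel> \<nu>) = \<infinity>\<close> the inequality holds trivially. This is also the reading for
  \<open>C = 0\<close>, where the convention \<open>0 * \<infinity> = 0\<close> would break the equivalence with the
  exponential moment bound.\<close>

definition transport_entropy_bound :: "'v set \<Rightarrow> 'a metric \<Rightarrow> real \<Rightarrow> ('v \<Rightarrow> 'a) measure \<Rightarrow> bool"
  where
  "transport_entropy_bound V M C \<nu> \<longleftrightarrow>
     (\<forall>\<mu>\<in>Prob (hamming_metric V M). \<forall>D::real. relative_entropy \<mu> \<nu> = ereal D \<longrightarrow>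
        transport_dist (hamming_metric V M) \<mu> \<nu> \<le> C / real (card V) * sqrt (D / 2))"

end

theory Submission
  imports Defs
begin

text \<open>
  Either form of the concentration inequality controls variances: if \<open>f\<close> is 1-Lipschitz with mean
  zero and \<open>\<bar>f\<bar> < 1\<close>, then \<open>n\<^sup>2 \<integral> f\<^sup>2 d\<nu> \<le> C\<^sup>2\<close>. The exponential moment bound gives this by comparing
  quadratic terms for small \<open>t\<close>; the transport bound gives it when applied to the measure
  \<open>(1 + f) \<nu>\<close>, which has entropy at most \<open>\<integral> f\<^sup>2 d\<nu>\<close> and whose distance to \<open>\<nu>\<close> is at least
  \<open>\<integral> f\<^sup>2 d\<nu>\<close> since it changes the mean of \<open>f\<close> by that amount. It therefore suffices to find one
  \<open>b\<close>-Lipschitz Markov measure with one Lipschitz function of large variance.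

  The measure is the symmetric two-state chain on the tree (the Ising model): the state space is
  \<open>{-1, 1}\<close> with the two points at distance 1, the root is uniform, and a vertex copies its parent
  with probability \<open>b\<close> and is otherwise resampled uniformly. Two copies that resample
  simultaneously and to the same value show that the kernel is \<open>b\<close>-Lipschitz. The function is
  \<open>f = (1 / 2 n) \<Sum>\<^sub>v y\<^sub>v\<close>.

  The signs \<open>y\<^sub>v\<close> are products of independent edge signs with mean \<open>b\<close> along the path from the
  root, times a symmetric sign at the root, so that the covariance of \<open>y\<^sub>v\<close> and \<open>y\<^sub>w\<close> is \<open>b\<close> to the
  power of the distance between \<open>v\<close> and \<open>w\<close> (lemma \<open>ising_covariance\<close>). The variance of \<open>n f\<close> is
  thus a quarter of the sum of \<open>b\<^bsup>d(v,w)\<^esup>\<close> over all pairs.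

  Expanding the squares in \<open>\<Delta>\<^sup>2\<close> yields, for each pair of vertices, a sum over their common
  ancestors. It is dominated by a geometric series with ratio \<open>b\<^sup>2\<close> that starts with \<open>b\<^bsup>d(v,w)\<^esup>\<close>,
  whence \<open>(1 - b\<^sup>2) \<Delta>\<^sup>2\<close> is at most the sum over all pairs (lemma \<open>desc_gen_norm_le\<close>). Altogether
  \<open>(1 - b\<^sup>2) \<Delta>\<^sup>2 \<le> 4 C\<^sup>2\<close>.
\<close>

section \<open>Paths and ancestors in a rooted tree\<close>

locale rooted_tree =
  fixes V :: "'v set" and E :: "'v set set" and \<rho> :: 'v
  assumes tree: "finite_rooted_tree V E \<rho>"
begin

abbreviation anc :: "'v \<Rightarrow> 'v set" where
  "anc v \<equiv> set (tree_path V E \<rho> v)"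

lemma finite_V: "finite V" and root_in_V: "\<rho> \<in> V"
  using tree by (auto simp: finite_rooted_tree_def)

lemma card_V_pos: "card V > 0"
  using finite_V root_in_V by (auto simp: card_gt_0_iff)

lemma simple_path_tree_path:
  assumes "u \<in> V" "v \<in> V"
  shows "simple_path V E u (tree_path V E u v) v"
  unfolding tree_path_def
  by (rule theI') (use tree assms in \<open>auto simp: finite_rooted_tree_def\<close>)

lemma tree_path_eqI:
  assumes "simple_path V E u p v"
  shows "tree_path V E u v = p"
proof -
  have "u \<in> V" "v \<in> V"
    using assms by (auto simp: simple_path_def)
  then have "\<exists>!p. simple_path V E u p v"
    using tree by (auto simp: finite_rooted_tree_def)
  with assms simple_path_tree_path[OF \<open>u \<in> V\<close> \<open>v \<in> V\<close>] show ?thesis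
    by blast
qed

lemma graph_dist_eq:
  assumes "u \<in> V" "v \<in> V"
  shows "graph_dist V E u v = length (tree_path V E u v) - 1"
proof -
  have "tree_path V E u v \<noteq> []"
    using simple_path_tree_path[OF assms] by (simp add: simple_path_def)
  then have len: "length (tree_path V E u v) = Suc (length (tree_path V E u v) - 1)"
    by simp
  show ?thesis
    unfolding graph_dist_def
  proof (rule Least_equality)
    show "\<exists>p. simple_path V E u p v \<and> length p = Suc (length (tree_path V E u v) - 1)"
      using simple_path_tree_path[OF assms] len by blast
    show "length (tree_path V E u v) - 1 \<le> k"
      if "\<exists>p. simple_path V E u p v \<and> length p = Suc k" for k
      using that tree_path_eqI by fastforce
  qed
qed

text \<open>
  Paths are unique, so every piece of the path from the root to \<open>w\<close> is the path between its ends.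
  All facts about ancestors come from this.
\<close>

lemma tree_path_split:
  assumes "w \<in> V" "tree_path V E \<rho> w = xs @ v # ys"
  shows "tree_path V E \<rho> v = xs @ [v]" "tree_path V E v w = v # ys" "v \<in> V"
proof -
  have p: "simple_path V E \<rho> (xs @ v # ys) w"
    using simple_path_tree_path[OF root_in_V assms(1)] assms(2) by simp
  then show "v \<in> V"
    by (auto simp: simple_path_def)
  have "simple_path V E \<rho> (xs @ [v]) v"
    using p by (cases xs) (auto simp: simple_path_def successively_append_iff successively_Cons hd_append)
  then show "tree_path V E \<rho> v = xs @ [v]"
    by (rule tree_path_eqI)
  have "simple_path V E v (v # ys) w"
    using p by (auto simp: simple_path_def successively_append_iff)
  then show "tree_path V E v w = v # ys"
    by (rule tree_path_eqI)
qed

lemma tree_path_root: "tree_path V E \<rho> \<rho> = [\<rho>]"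
  by (rule tree_path_eqI) (simp add: simple_path_def root_in_V)

lemma
  assumes "v \<in> V"
  shows tree_path_nonempty: "tree_path V E \<rho> v \<noteq> []"
    and root_in_anc: "\<rho> \<in> anc v"
    and anc_subset: "anc v \<subseteq> V"
    and card_anc: "card (anc v) = length (tree_path V E \<rho> v)"
  using simple_path_tree_path[OF root_in_V assms]
  by (auto simp: simple_path_def distinct_card dest: hd_in_set)

lemma graph_dist_root: "v \<in> V \<Longrightarrow> graph_dist V E \<rho> v = card (anc v) - 1"
  by (simp add: graph_dist_eq root_in_V card_anc)

lemma card_anc_pos: "v \<in> V \<Longrightarrow> card (anc v) > 0"
  by (simp add: card_anc tree_path_nonempty)

lemma anc_descent:
  assumes "w \<in> V" "v \<in> anc w"
  shows anc_trans: "anc v \<subseteq> anc w"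
    and graph_dist_anc: "graph_dist V E v w = card (anc w) - card (anc v)"
    and tree_path_take: "tree_path V E \<rho> v = take (card (anc v)) (tree_path V E \<rho> w)"
    and in_V_if_anc: "v \<in> V"
proof -
  obtain xs ys where s: "tree_path V E \<rho> w = xs @ v # ys"
    using assms(2) by (meson split_list)
  note sp = tree_path_split[OF assms(1) s]
  show "v \<in> V" by (fact sp(3))
  show "anc v \<subseteq> anc w"
    using s sp by auto
  have "card (anc v) = Suc (length xs)"
    using card_anc[OF sp(3)] sp(1) by simp
  then show "graph_dist V E v w = card (anc w) - card (anc v)"
    and "tree_path V E \<rho> v = take (card (anc v)) (tree_path V E \<rho> w)"
    using s sp card_anc[OF assms(1)] graph_dist_eq[OF sp(3) assms(1)] by auto
qed

text \<open>
  The ancestors of \<open>w\<close> form a chain, one for each depth.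
\<close>

lemma inj_on_card_anc:
  assumes "w \<in> V"
  shows "inj_on (\<lambda>v. card (anc v)) (anc w)"
proof (rule inj_onI)
  fix u v assume uv: "u \<in> anc w" "v \<in> anc w" "card (anc u) = card (anc v)"
  then have "tree_path V E \<rho> u = tree_path V E \<rho> v"
    using tree_path_take[OF assms] by metis
  moreover have "last (tree_path V E \<rho> x) = x" if "x \<in> V" for x
    using simple_path_tree_path[OF root_in_V that] by (simp add: simple_path_def)
  ultimately show "u = v"
    using uv in_V_if_anc[OF assms] by metis
qed

lemma tree_path_parent:
  assumes "v \<in> V" "v \<noteq> \<rho>"
  shows "parent V E \<rho> v \<in> V"
    and "tree_path V E \<rho> v = tree_path V E \<rho> (parent V E \<rho> v) @ [v]"
proof -
  have sp: "simple_path V E \<rho> (tree_path V E \<rho> v) v"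
    by (rule simple_path_tree_path[OF root_in_V assms(1)])
  define xs where "xs = butlast (tree_path V E \<rho> v)"
  have xs: "tree_path V E \<rho> v = xs @ [v]"
    using sp append_butlast_last_id unfolding xs_def simple_path_def by metis
  have "xs \<noteq> []"
    using sp xs assms(2) by (auto simp: simple_path_def)
  then have "tree_path V E \<rho> v = butlast xs @ parent V E \<rho> v # [v]"
    using xs by (simp add: parent_def)
  from tree_path_split[OF assms(1) this] this
  show "parent V E \<rho> v \<in> V"
    and "tree_path V E \<rho> v = tree_path V E \<rho> (parent V E \<rho> v) @ [v]"
    by auto
qed

lemma anc_parent:
  assumes "v \<in> V" "v \<noteq> \<rho>"
  shows "anc v = insert v (anc (parent V E \<rho> v))" "v \<notin> anc (parent V E \<rho> v)"
  using tree_path_parent[OF assms] simple_path_tree_path[OF root_in_V assms(1)]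
  by (auto simp: simple_path_def)

lemma graph_dist_parent:
  assumes "v \<in> V" "v \<noteq> \<rho>"
  shows "graph_dist V E \<rho> v = Suc (graph_dist V E \<rho> (parent V E \<rho> v))"
  using anc_parent[OF assms] tree_path_parent(1)[OF assms] card_anc_pos[of "parent V E \<rho> v"]
  by (simp add: graph_dist_root assms)

lemma graph_dist_eq_0_iff: "v \<in> V \<Longrightarrow> graph_dist V E \<rho> v = 0 \<longleftrightarrow> v = \<rho>"
  using graph_dist_parent[of v] graph_dist_eq[OF root_in_V root_in_V]
  by (cases "v = \<rho>") (auto simp: tree_path_root)

lemma desc_gen_eq:
  assumes "v \<in> V"
  shows "desc_gen V E \<rho> b v
    = (\<Sum>w\<in>V. if v \<in> anc w then b ^ (card (anc w) - card (anc v)) else 0)"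
proof -
  let ?D = "{w \<in> V. v \<in> anc w}" and ?d = "\<lambda>w. graph_dist V E v w"
  have "desc_gen V E \<rho> b v = (\<Sum>r\<in>?d ` ?D. real (card (descendants V E \<rho> r v)) * b ^ r)"
    unfolding desc_gen_def
  proof (rule suminf_finite)
    show "real (card (descendants V E \<rho> r v)) * b ^ r = 0" if "r \<notin> ?d ` ?D" for r
    proof -
      have "descendants V E \<rho> r v = {}"
        using that by (auto simp: descendants_def tree_le_def)
      then show ?thesis by simp
    qed
  qed (simp add: finite_V)
  also have "\<dots> = (\<Sum>r\<in>?d ` ?D. \<Sum>w | w \<in> ?D \<and> ?d w = r. b ^ ?d w)"
  proof (rule sum.cong[OF refl])
    fix r
    have "{w \<in> ?D. ?d w = r} = descendants V E \<rho> r v"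
      by (auto simp: descendants_def tree_le_def)
    then show "real (card (descendants V E \<rho> r v)) * b ^ r = (\<Sum>w | w \<in> ?D \<and> ?d w = r. b ^ ?d w)"
      by (simp add: descendants_def)
  qed
  also have "\<dots> = (\<Sum>w\<in>?D. b ^ ?d w)"
    by (rule sum.image_gen[symmetric]) (simp add: finite_V)
  also have "\<dots> = (\<Sum>w\<in>?D. b ^ (card (anc w) - card (anc v)))"
    by (intro sum.cong refl) (auto simp: graph_dist_anc)
  also have "\<dots> = (\<Sum>w\<in>V. if v \<in> anc w then b ^ (card (anc w) - card (anc v)) else 0)"
    by (simp add: sum.If_cases finite_V Int_def)
  finally show ?thesis .
qed

text \<open>
  The left-hand sum runs over the common ancestors of \<open>w\<close> and \<open>w'\<close>. As \<open>v\<close> moves up from the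
  last common ancestor, both distances grow by one at each step, so the summands decay
  geometrically with ratio \<open>b\<^sup>2\<close>. The first of them is \<open>b\<close> to the power of the distance between
  \<open>w\<close> and \<open>w'\<close>, which is the number of vertices on exactly one of their paths from the root.
\<close>

lemma common_anc_sum_le:
  fixes b :: real
  assumes b: "0 \<le> b" "b < 1" and w: "w \<in> V" "w' \<in> V"
  shows "(1 - b\<^sup>2) * (\<Sum>v\<in>anc w \<inter> anc w'.
            b ^ (card (anc w) - card (anc v)) * b ^ (card (anc w') - card (anc v)))
         \<le> b ^ card (sym_diff (anc w) (anc w'))"
proof -
  define I where "I = anc w \<inter> anc w'"
  define a where "a v = card (anc v)" for v
  have fin: "finite I" by (simp add: I_def)
  have anc_le: "a v \<le> card I" "v \<in> V" if "v \<in> I" for v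
    using that w anc_trans in_V_if_anc unfolding I_def a_def by (auto intro!: card_mono)
  have cI: "card I \<le> a w" "card I \<le> a w'"
    unfolding I_def a_def by (auto intro!: card_mono)
  have sd: "card (sym_diff (anc w) (anc w')) = (a w - card I) + (a w' - card I)"
    unfolding I_def a_def
    by (subst card_Un_disjoint) (auto simp: card_Diff_subset_Int Int_commute)
  have inj: "inj_on (\<lambda>v. card I - a v) I"
  proof (rule inj_onI)
    fix u v assume "u \<in> I" "v \<in> I" "card I - a u = card I - a v"
    then have "a u = a v" using anc_le by (metis diff_diff_cancel)
    then show "u = v"
      using inj_on_card_anc[OF w(1)] \<open>u \<in> I\<close> \<open>v \<in> I\<close> by (auto simp: inj_on_def I_def a_def)
  qed
  have "(\<Sum>v\<in>I. b ^ (a w - a v) * b ^ (a w' - a v))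
      = (\<Sum>v\<in>I. b ^ card (sym_diff (anc w) (anc w')) * (b\<^sup>2) ^ (card I - a v))"
  proof (rule sum.cong[OF refl])
    fix v assume "v \<in> I"
    then have "(a w - a v) + (a w' - a v)
        = card (sym_diff (anc w) (anc w')) + 2 * (card I - a v)"
      using anc_le[of v] cI unfolding sd by linarith
    then show "b ^ (a w - a v) * b ^ (a w' - a v)
        = b ^ card (sym_diff (anc w) (anc w')) * (b\<^sup>2) ^ (card I - a v)"
      by (metis power_add power_mult)
  qed
  also have "\<dots> = b ^ card (sym_diff (anc w) (anc w')) * (\<Sum>v\<in>I. (b\<^sup>2) ^ (card I - a v))"
    by (simp add: sum_distrib_left)
  also have "(\<Sum>v\<in>I. (b\<^sup>2) ^ (card I - a v)) = (\<Sum>j\<in>(\<lambda>v. card I - a v) ` I. (b\<^sup>2) ^ j)"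
    by (simp add: sum.reindex[OF inj])
  finally have eq: "(\<Sum>v\<in>I. b ^ (a w - a v) * b ^ (a w' - a v))
      = b ^ card (sym_diff (anc w) (anc w')) * (\<Sum>j\<in>(\<lambda>v. card I - a v) ` I. (b\<^sup>2) ^ j)" .
  have "(\<Sum>j\<in>(\<lambda>v. card I - a v) ` I. (b\<^sup>2) ^ j) \<le> (\<Sum>j\<le>card I. (b\<^sup>2) ^ j)"
    by (rule sum_mono2) auto
  then have "(1 - b\<^sup>2) * (\<Sum>j\<in>(\<lambda>v. card I - a v) ` I. (b\<^sup>2) ^ j)
      \<le> (1 - b\<^sup>2) * (\<Sum>j\<le>card I. (b\<^sup>2) ^ j)"
    using b by (intro mult_left_mono) (auto simp: power_le_one)
  also have "\<dots> = 1 - (b\<^sup>2) ^ Suc (card I)"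
    by (simp add: sum_gp_basic)
  also have "\<dots> \<le> 1" by simp
  finally have le: "(1 - b\<^sup>2) * (\<Sum>j\<in>(\<lambda>v. card I - a v) ` I. (b\<^sup>2) ^ j) \<le> 1" .
  have "(1 - b\<^sup>2) * (\<Sum>v\<in>I. b ^ (a w - a v) * b ^ (a w' - a v))
      = b ^ card (sym_diff (anc w) (anc w'))
        * ((1 - b\<^sup>2) * (\<Sum>j\<in>(\<lambda>v. card I - a v) ` I. (b\<^sup>2) ^ j))"
    unfolding eq by (simp only: mult_ac)
  also have "\<dots> \<le> b ^ card (sym_diff (anc w) (anc w')) * 1"
    using le b(1) by (intro mult_left_mono) auto
  finally show ?thesis
    unfolding I_def a_def by simp
qed

text \<open>
  Squaring the generating function gives a sum over pairs of descendants; exchanging the sums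
  turns it into a sum over pairs of vertices and their common ancestors.
\<close>

lemma desc_gen_norm_le:
  fixes b :: real
  assumes "0 \<le> b" "b < 1"
  shows "(1 - b\<^sup>2) * (desc_gen_norm V E \<rho> b)\<^sup>2
           \<le> (\<Sum>w\<in>V. \<Sum>w'\<in>V. b ^ card (sym_diff (anc w) (anc w')))"
proof -
  define h where
    "h v w = (if v \<in> anc w then b ^ (card (anc w) - card (anc v)) else 0)" for v w
  have "(desc_gen_norm V E \<rho> b)\<^sup>2 = (\<Sum>v\<in>V. (desc_gen V E \<rho> b v)\<^sup>2)"
    unfolding desc_gen_norm_def by (simp add: sum_nonneg)
  also have "\<dots> = (\<Sum>v\<in>V. \<Sum>w\<in>V. \<Sum>w'\<in>V. h v w * h v w')"
    by (simp add: desc_gen_eq h_def power2_eq_square sum_product)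
  also have "\<dots> = (\<Sum>w\<in>V. \<Sum>w'\<in>V. \<Sum>v\<in>V. h v w * h v w')"
    by (subst sum.swap, rule sum.cong[OF refl], rule sum.swap)
  finally have "(1 - b\<^sup>2) * (desc_gen_norm V E \<rho> b)\<^sup>2
      = (\<Sum>w\<in>V. \<Sum>w'\<in>V. (1 - b\<^sup>2) * (\<Sum>v\<in>V. h v w * h v w'))"
    by (simp add: sum_distrib_left)
  also have "\<dots> \<le> (\<Sum>w\<in>V. \<Sum>w'\<in>V. b ^ card (sym_diff (anc w) (anc w')))"
  proof (intro sum_mono)
    fix w w' assume w: "w \<in> V" "w' \<in> V"
    have "(\<Sum>v\<in>V. h v w * h v w') = (\<Sum>v\<in>anc w \<inter> anc w'. h v w * h v w')"
      by (rule sum.mono_neutral_right)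
         (use finite_V anc_subset[OF w(1)] in \<open>auto simp: h_def\<close>)
    also have "\<dots> = (\<Sum>v\<in>anc w \<inter> anc w'.
        b ^ (card (anc w) - card (anc v)) * b ^ (card (anc w') - card (anc v)))"
      by (rule sum.cong) (auto simp: h_def)
    finally show "(1 - b\<^sup>2) * (\<Sum>v\<in>V. h v w * h v w') \<le> b ^ card (sym_diff (anc w) (anc w'))"
      using common_anc_sum_le[OF assms w] by simp
  qed
  finally show ?thesis .
qed

end


section \<open>The Ising model on a tree\<close>

abbreviation signs :: "real set" where
  "signs \<equiv> {-1, 1}"

lemma prod_in_signs: "(\<And>u. u \<in> A \<Longrightarrow> f u \<in> signs) \<Longrightarrow> prod f A \<in> signs"
proof (induction A rule: infinite_finite_induct)
  case (insert x F)
  then have "f x \<in> signs" "prod f F \<in> signs"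
    by blast+
  with insert.hyps show ?case
    by auto
qed auto

context rooted_tree
begin

abbreviation configs :: "('v \<Rightarrow> real) set" where
  "configs \<equiv> V \<rightarrow>\<^sub>E signs"

text \<open>
  Changes coordinates from edge signs to vertex signs: \<open>e v\<close> says whether \<open>v\<close> and its parent carry
  equal signs, and \<open>e \<rho>\<close> is the sign of the root.
\<close>

definition path_prod :: "('v \<Rightarrow> real) \<Rightarrow> 'v \<Rightarrow> real" where
  "path_prod e = (\<lambda>v\<in>V. \<Prod>u\<in>anc v. e u)"

text \<open>
  The free-boundary Ising measure on the tree: the root is uniform, and each vertex copies its
  parent with probability \<open>b\<close> and is otherwise a fresh uniform sign.
\<close>

definition ising_weight :: "real \<Rightarrow> ('v \<Rightarrow> real) \<Rightarrow> real" where
  "ising_weight b y = 1 / 2 * (\<Prod>v\<in>V - {\<rho>}. (1 + b * y (parent V E \<rho> v) * y v) / 2)"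

lemma finite_configs: "finite configs"
  using finite_V by (intro finite_PiE) auto

lemma path_prod_in_configs: "e \<in> configs \<Longrightarrow> path_prod e \<in> configs"
  using anc_subset unfolding path_prod_def
  by (auto intro!: prod_in_signs simp del: insert_iff)

lemma path_prod_root: "path_prod e \<rho> = e \<rho>"
  by (simp add: path_prod_def root_in_V tree_path_root)

lemma path_prod_parent:
  assumes "v \<in> V" "v \<noteq> \<rho>"
  shows "path_prod e v = e v * path_prod e (parent V E \<rho> v)"
  using anc_parent[OF assms] tree_path_parent(1)[OF assms] assms
  by (simp add: path_prod_def)

lemma sign_square: "x \<in> signs \<Longrightarrow> x * x = 1"
  by auto

lemma path_prod_increment:
  assumes "e \<in> configs" "v \<in> V" "v \<noteq> \<rho>"
  shows "path_prod e (parent V E \<rho> v) * path_prod e v = e v"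
proof -
  have "path_prod e (parent V E \<rho> v) \<in> signs"
    using path_prod_in_configs[OF assms(1)] tree_path_parent(1)[OF assms(2,3)] by (rule PiE_mem)
  then show ?thesis
    using path_prod_parent[OF assms(2,3), of e] sign_square by (simp add: mult.left_commute)
qed

lemma bij_betw_path_prod: "bij_betw path_prod configs configs"
proof -
  have "inj_on path_prod configs"
  proof (rule inj_onI)
    fix e e' assume e: "e \<in> configs" "e' \<in> configs" "path_prod e = path_prod e'"
    have "e v = e' v" if "v \<in> V" for v
      using e that path_prod_root path_prod_increment by (cases "v = \<rho>") metis+
    then show "e = e'"
      using e by (intro PiE_ext)
  qed
  moreover have "path_prod ` configs \<subseteq> configs"
    using path_prod_in_configs by blast
  ultimately show ?thesis
    using finite_configs by (simp add: bij_betw_def endo_inj_surj)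
qed

text \<open>
  In the edge coordinates the weight factorises: the signs are independent, with mean \<open>b\<close>
  except for the symmetric sign of the root. This is what makes all moments computable.
\<close>

lemma ising_weight_path_prod:
  assumes "e \<in> configs"
  shows "ising_weight b (path_prod e) = (\<Prod>u\<in>V. (1 + (if u = \<rho> then 0 else b) * e u) / 2)"
proof -
  have "ising_weight b (path_prod e) = 1 / 2 * (\<Prod>u\<in>V - {\<rho>}. (1 + b * e u) / 2)"
    unfolding ising_weight_def
    by (intro arg_cong2[where f = "(*)"] prod.cong refl)
       (use path_prod_increment[OF assms] in \<open>simp add: mult.assoc\<close>)
  also have "(\<Prod>u\<in>V - {\<rho>}. (1 + b * e u) / 2)
      = (\<Prod>u\<in>V - {\<rho>}. (1 + (if u = \<rho> then 0 else b) * e u) / 2)"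
    by (rule prod.cong) auto
  finally show ?thesis
    by (simp add: prod.remove[OF finite_V root_in_V])
qed

lemma sum_ising_weight_path_prod:
  assumes "A \<subseteq> V"
  shows "(\<Sum>e\<in>configs. ising_weight b (path_prod e) * (\<Prod>u\<in>A. e u))
    = (\<Prod>u\<in>A. if u = \<rho> then 0 else b)"
proof -
  define \<beta> where "\<beta> u = (if u = \<rho> then 0 else b)" for u
  define h where "h u x = (1 + \<beta> u * x) / 2 * (if u \<in> A then x else 1)" for u x
  have "(\<Sum>e\<in>configs. ising_weight b (path_prod e) * (\<Prod>u\<in>A. e u)) = (\<Sum>e\<in>configs. \<Prod>u\<in>V. h u (e u))"
  proof (rule sum.cong[OF refl])
    fix e assume "e \<in> configs"
    moreover have "(\<Prod>u\<in>A. e u) = (\<Prod>u\<in>V. if u \<in> A then e u else 1)"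
      using assms finite_V by (simp add: prod.If_cases Int_absorb1)
    ultimately show "ising_weight b (path_prod e) * (\<Prod>u\<in>A. e u) = (\<Prod>u\<in>V. h u (e u))"
      by (simp add: ising_weight_path_prod h_def \<beta>_def flip: prod.distrib)
  qed
  also have "\<dots> = (\<Prod>u\<in>V. \<Sum>x\<in>signs. h u x)"
    by (rule prod_sum_PiE[symmetric]) (auto simp: finite_V)
  also have "\<dots> = (\<Prod>u\<in>V. if u \<in> A then \<beta> u else 1)"
    by (intro prod.cong refl) (simp add: h_def field_simps)
  also have "\<dots> = (\<Prod>u\<in>A. \<beta> u)"
    using assms finite_V by (simp add: prod.If_cases Int_absorb1)
  finally show ?thesis
    unfolding \<beta>_def .
qed

lemma sum_ising_weight_reindex:
  "(\<Sum>y\<in>configs. ising_weight b y * g y)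
    = (\<Sum>e\<in>configs. ising_weight b (path_prod e) * g (path_prod e))"
  by (rule sum.reindex_bij_betw[OF bij_betw_path_prod, symmetric])

lemma sum_ising_weight: "(\<Sum>y\<in>configs. ising_weight b y) = 1"
  using sum_ising_weight_reindex[of b "\<lambda>_. 1"] sum_ising_weight_path_prod[of "{}" b] by simp

lemma ising_mean:
  assumes "v \<in> V"
  shows "(\<Sum>y\<in>configs. ising_weight b y * y v) = 0"
proof -
  have "(\<Sum>y\<in>configs. ising_weight b y * y v)
      = (\<Sum>e\<in>configs. ising_weight b (path_prod e) * (\<Prod>u\<in>anc v. e u))"
    using assms by (simp add: sum_ising_weight_reindex path_prod_def)
  also have "\<dots> = 0"
    using root_in_anc[OF assms]
    by (subst sum_ising_weight_path_prod[OF anc_subset[OF assms]]) auto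
  finally show ?thesis .
qed

text \<open>
  In the product of two path products the edge signs of common ancestors cancel, being squares.
\<close>

lemma ising_covariance:
  assumes "v \<in> V" "w \<in> V"
  shows "(\<Sum>y\<in>configs. ising_weight b y * (y v * y w)) = b ^ card (sym_diff (anc v) (anc w))"
proof -
  have "(\<Sum>y\<in>configs. ising_weight b y * (y v * y w))
      = (\<Sum>e\<in>configs. ising_weight b (path_prod e) * (path_prod e v * path_prod e w))"
    by (rule sum_ising_weight_reindex)
  also have "\<dots> = (\<Sum>e\<in>configs. ising_weight b (path_prod e) * (\<Prod>u\<in>sym_diff (anc v) (anc w). e u))"
  proof (intro sum.cong refl arg_cong2[where f = "(*)"])
    fix e assume e: "e \<in> configs"
    have "(\<Prod>u\<in>anc v. e u) * (\<Prod>u\<in>anc w. e u)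
        = ((\<Prod>u\<in>anc v - anc w. e u) * (\<Prod>u\<in>anc v \<inter> anc w. e u))
          * ((\<Prod>u\<in>anc w - anc v. e u) * (\<Prod>u\<in>anc v \<inter> anc w. e u))"
      by (simp flip: prod.union_disjoint add: Un_Diff_Int Int_commute Un_commute
          prod.Int_Diff[of "anc v" _ "anc w"] prod.Int_Diff[of "anc w" _ "anc v"])
    also have "\<dots> = (\<Prod>u\<in>anc v - anc w. e u) * (\<Prod>u\<in>anc w - anc v. e u)
          * ((\<Prod>u\<in>anc v \<inter> anc w. e u) * (\<Prod>u\<in>anc v \<inter> anc w. e u))"
      by (simp only: mult_ac)
    also have "(\<Prod>u\<in>anc v \<inter> anc w. e u) \<in> signs"
      using e anc_subset[OF assms(1)] by (intro prod_in_signs) (auto simp del: insert_iff)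
    then have "(\<Prod>u\<in>anc v \<inter> anc w. e u) * (\<Prod>u\<in>anc v \<inter> anc w. e u) = 1"
      by (rule sign_square)
    finally show "path_prod e v * path_prod e w = (\<Prod>u\<in>sym_diff (anc v) (anc w). e u)"
      using assms by (subst prod.union_disjoint) (auto simp: path_prod_def)
  qed
  also have "\<dots> = (\<Prod>u\<in>sym_diff (anc v) (anc w). if u = \<rho> then 0 else b)"
    by (rule sum_ising_weight_path_prod) (use anc_subset assms in auto)
  also have "\<dots> = (\<Prod>u\<in>sym_diff (anc v) (anc w). b)"
    using root_in_anc assms by (intro prod.cong) auto
  finally show ?thesis
    by simp
qed

end


section \<open>Iterated integrals of kernels with finite support\<close>


lemma PiM_point_measure:
  fixes g :: "'i \<Rightarrow> 'a \<Rightarrow> real"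
  assumes "finite I" "finite S"
  shows "(\<Pi>\<^sub>M i\<in>I. point_measure S (\<lambda>s. ennreal (g i s)))
    = point_measure (I \<rightarrow>\<^sub>E S) (\<lambda>z. \<Prod>i\<in>I. ennreal (g i (z i)))"
proof (rule measure_eqI_finite)
  let ?Q = "\<lambda>i. point_measure S (\<lambda>s. ennreal (g i s))"
  interpret product_sigma_finite ?Q
  proof (rule product_sigma_finite.intro)
    fix i
    have "finite_measure (?Q i)"
      by (rule finite_measureI)
         (simp add: space_point_measure emeasure_point_measure_finite assms(2))
    then show "sigma_finite_measure (?Q i)"
      by (simp add: finite_measure_def)
  qed
  show fin: "finite (I \<rightarrow>\<^sub>E S)"
    using assms by (intro finite_PiE) auto
  have single: "{z} = (\<Pi>\<^sub>E i\<in>I. {z i})" if "z \<in> I \<rightarrow>\<^sub>E S" for z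
    using that by (auto intro: PiE_ext)
  have singles: "{z} \<in> sets (PiM I ?Q)" if "z \<in> I \<rightarrow>\<^sub>E S" for z
    unfolding single[OF that] using that assms(1)
    by (intro sets_PiM_I_finite) (auto simp: sets_point_measure)
  show "sets (PiM I ?Q) = Pow (I \<rightarrow>\<^sub>E S)"
  proof
    show "sets (PiM I ?Q) \<subseteq> Pow (I \<rightarrow>\<^sub>E S)"
      using sets.sets_into_space[of _ "PiM I ?Q"] by (auto simp: space_PiM space_point_measure)
    show "Pow (I \<rightarrow>\<^sub>E S) \<subseteq> sets (PiM I ?Q)"
    proof
      fix A assume A: "A \<in> Pow (I \<rightarrow>\<^sub>E S)"
      then have "(\<Union>z\<in>A. {z}) \<in> sets (PiM I ?Q)"
        using fin by (intro sets.finite_UN singles) (auto intro: finite_subset)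
      then show "A \<in> sets (PiM I ?Q)" by simp
    qed
  qed
  show "emeasure (PiM I ?Q) {z}
      = emeasure (point_measure (I \<rightarrow>\<^sub>E S) (\<lambda>z. \<Prod>i\<in>I. ennreal (g i (z i)))) {z}"
    if "z \<in> I \<rightarrow>\<^sub>E S" for z
  proof -
    have "emeasure (PiM I ?Q) {z} = (\<Prod>i\<in>I. emeasure (?Q i) {z i})"
      unfolding single[OF that]
      by (rule emeasure_PiM) (use that assms in \<open>auto simp: sets_point_measure\<close>)
    also have "\<dots> = (\<Prod>i\<in>I. ennreal (g i (z i)))"
    proof (rule prod.cong[OF refl])
      fix i assume "i \<in> I"
      with that have "z i \<in> S"
        by (rule PiE_mem)
      then show "emeasure (?Q i) {z i} = ennreal (g i (z i))"
        using assms(2) by (simp add: emeasure_point_measure_finite)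
    qed
    finally show ?thesis
      using that fin by (simp add: emeasure_point_measure_finite)
  qed
qed (simp add: sets_point_measure)

context rooted_tree
begin

abbreviation upto_level :: "nat \<Rightarrow> 'v set" where
  "upto_level k \<equiv> \<Union>j<k. level V E \<rho> j"

lemma in_upto_level: "v \<in> upto_level k \<longleftrightarrow> v \<in> V \<and> graph_dist V E \<rho> v < k"
  by (auto simp: level_def)

lemma finite_level: "finite (level V E \<rho> k)" "finite (upto_level k)"
  using finite_V by (auto simp: level_def)

lemma level_0: "level V E \<rho> 0 = {\<rho>}"
  using root_in_V by (auto simp: level_def graph_dist_eq_0_iff)

lemma upto_level_depth: "upto_level (Suc (depth V E \<rho>)) = V"
proof -
  have "graph_dist V E \<rho> v \<le> depth V E \<rho>" if "v \<in> V" for v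
    unfolding depth_def using that finite_V by (intro Max_ge) auto
  then show ?thesis
    by (auto simp: level_def less_Suc_eq_le)
qed

text \<open>
  With kernels of finite support the iterated integral is a sum over all extensions of the values
  already assigned. Writing an extension as a full configuration with prescribed restriction,
  instead of a family of new values, lets the induction over the levels regroup one sum.
\<close>

lemma level_integral_point_measure:
  fixes g :: "'a \<Rightarrow> 'a \<Rightarrow> real"
  assumes "finite S" "1 \<le> k" "y \<in> upto_level k \<rightarrow>\<^sub>E S"
  shows "level_integral V E \<rho> (\<lambda>_ x. point_measure S (\<lambda>s. ennreal (g x s))) F m k y
    = (\<Sum>x | x \<in> upto_level (k + m) \<rightarrow>\<^sub>E S \<and> restrict x (upto_level k) = y.
        (\<Prod>v\<in>upto_level (k + m) - upto_level k. ennreal (g (x (parent V E \<rho> v)) (x v))) * F x)"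
  using assms(2,3)
proof (induction m arbitrary: k y)
  case 0
  then have eq: "{x \<in> upto_level k \<rightarrow>\<^sub>E S. restrict x (upto_level k) = y} = {y}"
    by (auto simp: PiE_restrict simp del: UN_simps)
  then show ?case
    unfolding level_integral.simps add_0_right eq Diff_cancel by simp
next
  case (Suc m)
  define L where "L = level V E \<rho> k"
  define W where "W = upto_level k"
  define U where "U = upto_level (k + Suc m)"
  define X where "X = {x \<in> U \<rightarrow>\<^sub>E S. restrict x W = y}"
  define h where "h x v = ennreal (g (x (parent V E \<rho> v)) (x v))" for x v
  have sub: "W \<subseteq> U" "L \<subseteq> U" "W \<inter> L = {}" and WL: "upto_level (Suc k) = W \<union> L"
    by (auto simp: W_def U_def L_def level_def less_Suc_eq)
  have fin: "finite U" "finite W" "finite L"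
    by (simp_all add: U_def W_def L_def finite_level)
  have y: "y \<in> W \<rightarrow>\<^sub>E S"
    using Suc.prems by (simp add: W_def)
  have par: "parent V E \<rho> v \<in> W" if "v \<in> L" for v
  proof -
    have v: "v \<in> V" "graph_dist V E \<rho> v = k"
      using that by (auto simp: L_def level_def)
    then have "v \<noteq> \<rho>"
      using Suc.prems(1) graph_dist_eq_0_iff by fastforce
    then show ?thesis
      using graph_dist_parent[of v] tree_path_parent(1)[of v] v
      unfolding W_def in_upto_level by simp
  qed
  have merge: "merge W L (y, z) \<in> (W \<union> L) \<rightarrow>\<^sub>E S" if "z \<in> L \<rightarrow>\<^sub>E S" for z
    using y that by (auto simp: merge_def PiE_iff extensional_def)
  have fib: "{x \<in> U \<rightarrow>\<^sub>E S. restrict x (W \<union> L) = merge W L (y, z)} = {x \<in> X. restrict x L = z}"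
    if z: "z \<in> L \<rightarrow>\<^sub>E S" for z
  proof -
    have "restrict x (W \<union> L) = merge W L (y, z) \<longleftrightarrow> restrict x W = y \<and> restrict x L = z" for x
    proof
      assume eq: "restrict x (W \<union> L) = merge W L (y, z)"
      have "x v = merge W L (y, z) v" if "v \<in> W \<union> L" for v
        using fun_cong[OF eq, of v] that by simp
      then show "restrict x W = y \<and> restrict x L = z"
        using y z sub(3)
        by (auto simp: merge_def PiE_iff extensional_def fun_eq_iff disjoint_iff)
    next
      assume "restrict x W = y \<and> restrict x L = z"
      then show "restrict x (W \<union> L) = merge W L (y, z)"
        by (auto simp: merge_def)
    qed
    then show ?thesis
      by (auto simp: X_def)
  qed
  note PiM = PiM_point_measure[OF fin(3) assms(1)]
  have finL: "finite (L \<rightarrow>\<^sub>E S)"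
    using fin assms(1) by (auto intro!: finite_PiE)
  have "level_integral V E \<rho> (\<lambda>_ x. point_measure S (\<lambda>s. ennreal (g x s))) F (Suc m) k y
      = (\<Sum>z\<in>L \<rightarrow>\<^sub>E S. (\<Prod>v\<in>L. ennreal (g (y (parent V E \<rho> v)) (z v)))
          * level_integral V E \<rho> (\<lambda>_ x. point_measure S (\<lambda>s. ennreal (g x s))) F m (Suc k)
              (merge W L (y, z)))"
    unfolding level_integral.simps L_def[symmetric] W_def[symmetric] PiM
    by (rule nn_integral_point_measure_finite[OF finL])
  also have "\<dots> = (\<Sum>z\<in>L \<rightarrow>\<^sub>E S. \<Sum>x | x \<in> X \<and> restrict x L = z. (\<Prod>v\<in>U - W. h x v) * F x)"
  proof (rule sum.cong[OF refl])
    fix z assume z: "z \<in> L \<rightarrow>\<^sub>E S"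
    have one_le: "1 \<le> Suc k"
      by simp
    have "level_integral V E \<rho> (\<lambda>_ x. point_measure S (\<lambda>s. ennreal (g x s))) F m (Suc k)
              (merge W L (y, z))
        = (\<Sum>x | x \<in> U \<rightarrow>\<^sub>E S \<and> restrict x (W \<union> L) = merge W L (y, z).
              (\<Prod>v\<in>U - (W \<union> L). h x v) * F x)"
      using Suc.IH[of "Suc k" "merge W L (y, z)", unfolded WL, OF one_le merge[OF z]]
      unfolding h_def U_def add_Suc add_Suc_right .
    also have "\<dots> = (\<Sum>x | x \<in> X \<and> restrict x L = z. (\<Prod>v\<in>U - (W \<union> L). h x v) * F x)"
      by (simp only: fib[OF z])
    finally have "(\<Prod>v\<in>L. ennreal (g (y (parent V E \<rho> v)) (z v)))
          * level_integral V E \<rho> (\<lambda>_ x. point_measure S (\<lambda>s. ennreal (g x s))) F m (Suc k)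
              (merge W L (y, z))
        = (\<Sum>x | x \<in> X \<and> restrict x L = z. (\<Prod>v\<in>L. ennreal (g (y (parent V E \<rho> v)) (z v)))
              * ((\<Prod>v\<in>U - (W \<union> L). h x v) * F x))"
      by (simp add: sum_distrib_left)
    also have "\<dots> = (\<Sum>x | x \<in> X \<and> restrict x L = z. (\<Prod>v\<in>U - W. h x v) * F x)"
    proof (rule sum.cong[OF refl])
      fix x assume "x \<in> {x \<in> X. restrict x L = z}"
      then have x: "restrict x W = y" "restrict x L = z"
        by (auto simp: X_def)
      have "U - W - L = U - (W \<union> L)" "L \<subseteq> U - W"
        using sub by auto
      then have "(\<Prod>v\<in>U - W. h x v) = (\<Prod>v\<in>L. h x v) * (\<Prod>v\<in>U - (W \<union> L). h x v)"
        using fin prod.subset_diff[of L "U - W" "h x"] by (simp add: mult.commute)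
      moreover have "(\<Prod>v\<in>L. h x v) = (\<Prod>v\<in>L. ennreal (g (y (parent V E \<rho> v)) (z v)))"
        unfolding h_def x[symmetric] using par by (intro prod.cong) auto
      ultimately show "(\<Prod>v\<in>L. ennreal (g (y (parent V E \<rho> v)) (z v)))
              * ((\<Prod>v\<in>U - (W \<union> L). h x v) * F x) = (\<Prod>v\<in>U - W. h x v) * F x"
        by (simp add: mult.assoc)
    qed
    finally show "(\<Prod>v\<in>L. ennreal (g (y (parent V E \<rho> v)) (z v)))
          * level_integral V E \<rho> (\<lambda>_ x. point_measure S (\<lambda>s. ennreal (g x s))) F m (Suc k)
              (merge W L (y, z))
        = (\<Sum>x | x \<in> X \<and> restrict x L = z. (\<Prod>v\<in>U - W. h x v) * F x)" .
  qed
  also have "\<dots> = (\<Sum>x\<in>X. (\<Prod>v\<in>U - W. h x v) * F x)"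
  proof (rule sum.group)
    show "finite X"
      unfolding X_def using fin assms(1) by (auto intro!: finite_PiE)
    show "finite (L \<rightarrow>\<^sub>E S)"
      by (fact finL)
    show "(\<lambda>x. restrict x L) ` X \<subseteq> L \<rightarrow>\<^sub>E S"
      using sub(2) by (auto simp: X_def)
  qed
  finally show ?case
    unfolding X_def U_def W_def h_def mem_Collect_eq .
qed

lemma nn_integral_level_integral_point_measure:
  fixes g :: "'a \<Rightarrow> 'a \<Rightarrow> real"
  assumes "finite S"
  shows "(\<integral>\<^sup>+ x. level_integral V E \<rho> (\<lambda>_ x. point_measure S (\<lambda>s. ennreal (g x s))) F
              (depth V E \<rho>) 1 (\<lambda>v\<in>{\<rho>}. x) \<partial>point_measure S (\<lambda>s. ennreal (p s)))
    = (\<Sum>y\<in>V \<rightarrow>\<^sub>E S. ennreal (p (y \<rho>))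
          * (\<Prod>v\<in>V - {\<rho>}. ennreal (g (y (parent V E \<rho> v)) (y v))) * F y)"
proof -
  let ?h = "\<lambda>y. ennreal (p (y \<rho>)) * (\<Prod>v\<in>V - {\<rho>}. ennreal (g (y (parent V E \<rho> v)) (y v))) * F y"
  have up1: "upto_level 1 = {\<rho>}"
    using level_0 by auto
  have "level_integral V E \<rho> (\<lambda>_ x. point_measure S (\<lambda>s. ennreal (g x s))) F
              (depth V E \<rho>) 1 (\<lambda>v\<in>{\<rho>}. x)
      = (\<Sum>y | y \<in> V \<rightarrow>\<^sub>E S \<and> y \<rho> = x.
          (\<Prod>v\<in>V - {\<rho>}. ennreal (g (y (parent V E \<rho> v)) (y v))) * F y)" if "x \<in> S" for x
  proof -
    have "restrict y {\<rho>} = (\<lambda>v\<in>{\<rho>}. x) \<longleftrightarrow> y \<rho> = x" for y :: "'v \<Rightarrow> 'a"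
      by (auto simp: restrict_def fun_eq_iff)
    then show ?thesis
      using level_integral_point_measure[OF assms, of 1 "\<lambda>v\<in>{\<rho>}. x" g F "depth V E \<rho>"] that
      unfolding up1 plus_1_eq_Suc upto_level_depth by simp
  qed
  then have "(\<integral>\<^sup>+ x. level_integral V E \<rho> (\<lambda>_ x. point_measure S (\<lambda>s. ennreal (g x s))) F
              (depth V E \<rho>) 1 (\<lambda>v\<in>{\<rho>}. x) \<partial>point_measure S (\<lambda>s. ennreal (p s)))
      = (\<Sum>x\<in>S. \<Sum>y | y \<in> V \<rightarrow>\<^sub>E S \<and> y \<rho> = x. ?h y)"
    using assms by (simp add: nn_integral_point_measure_finite sum_distrib_left mult.assoc)
  also have "\<dots> = (\<Sum>y\<in>V \<rightarrow>\<^sub>E S. ?h y)"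
    by (rule sum.group) (use assms finite_V root_in_V in \<open>auto intro!: finite_PiE\<close>)
  finally show ?thesis .
qed

end


section \<open>Concentration and variance on finite metric spaces\<close>


lemma mtopology_of_finite:
  assumes "finite (mspace M)"
  shows "mtopology_of M = discrete_topology (mspace M)"
proof -
  interpret Metric_space "mspace M" "mdist M" by simp
  have "openin mtopology {x}" if "x \<in> mspace M" for x
  proof -
    have "closedin mtopology (mspace M - {x})"
      using assms by (intro closedin_Hausdorff_finite[OF Hausdorff_space_mtopology]) auto
    then have "openin mtopology (topspace mtopology - (mspace M - {x}))"
      by blast
    moreover have "topspace mtopology - (mspace M - {x}) = {x}"
      using that by auto
    ultimately show ?thesis by simp
  qed
  then show ?thesis
    unfolding mtopology_of_def by (subst eq_commute) (auto simp: discrete_topology_unique)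
qed

lemma sets_metric_borel_finite:
  assumes "finite (mspace M)"
  shows "sets (metric_borel M) = Pow (mspace M)"
proof -
  have "{U. openin (mtopology_of M) U} = Pow (mspace M)"
    by (auto simp: mtopology_of_finite[OF assms])
  then show ?thesis
    by (simp add: metric_borel_def sigma_algebra.sigma_sets_eq[OF sigma_algebra_Pow])
qed

lemma space_metric_borel [simp]: "space (metric_borel M) = mspace M"
  by (simp add: metric_borel_def space_measure_of_conv)

lemma in_Prob_finite_iff:
  "finite (mspace M) \<Longrightarrow> \<mu> \<in> Prob M \<longleftrightarrow> prob_space \<mu> \<and> sets \<mu> = Pow (mspace M)"
  by (auto simp: Prob_def space_prob_algebra sets_metric_borel_finite)

lemma polish_metric_finite:
  assumes "finite (mspace M)"
  shows "polish_metric M"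
proof -
  interpret Metric_space "mspace M" "mdist M" by simp
  have "compact_space mtopology"
    using mtopology_of_finite[OF assms] assms
    by (simp add: mtopology_of_def compact_space_discrete_topology)
  then have "mcomplete_of M"
    unfolding mcomplete_of_def by (rule compact_space_imp_mcomplete)
  then show ?thesis
    unfolding polish_metric_def mtopology_of_finite[OF assms] separable_space_discrete_topology
    using assms by (simp add: countable_finite)
qed

lemma borel_measurable_Pow:
  "sets N = Pow A \<Longrightarrow> f \<in> borel_measurable N"
  using sets_eq_imp_space_eq[of N "count_space A"]
  by (intro measurableI) auto

lemma integrable_Pow_finite:
  fixes f :: "'a \<Rightarrow> real"
  assumes "finite_measure N" "sets N = Pow A" "finite A"
  shows "integrable N f"
proof -
  interpret finite_measure N by fact
  have sp: "space N = A"
    using sets_eq_imp_space_eq[of N "count_space A"] assms(2) by simp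
  show ?thesis
  proof (rule integrable_const_bound)
    show "f \<in> borel_measurable N"
      by (rule borel_measurable_Pow[OF assms(2)])
    show "AE x in N. norm (f x) \<le> (\<Sum>x\<in>A. norm (f x))"
      by (rule AE_I2) (use assms(3) sp in \<open>auto intro!: member_le_sum\<close>)
  qed
qed

text \<open>
  The easy half of Kantorovich duality. The product coupling is needed because the infimum over an
  empty set of reals would be unspecified.
\<close>

lemma integral_diff_le_transport_dist:
  assumes fin: "finite (mspace M)" and "\<mu> \<in> Prob M" "\<nu> \<in> Prob M" and f: "lipschitz1 M f"
  shows "(\<integral>x. f x \<partial>\<mu>) - (\<integral>x. f x \<partial>\<nu>) \<le> transport_dist M \<mu> \<nu>"
proof -
  let ?B = "metric_borel M"
  interpret \<mu>: prob_space \<mu>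
    using assms(2) in_Prob_finite_iff[OF fin] by blast
  interpret \<nu>: prob_space \<nu>
    using assms(3) in_Prob_finite_iff[OF fin] by blast
  have sets: "sets \<mu> = sets ?B" "sets \<nu> = sets ?B"
    using assms(2,3) in_Prob_finite_iff[OF fin] sets_metric_borel_finite[OF fin] by auto
  have setsBB: "sets (?B \<Otimes>\<^sub>M ?B) = Pow (mspace M \<times> mspace M)"
  proof -
    have "sets (?B \<Otimes>\<^sub>M ?B) = sets (count_space (mspace M) \<Otimes>\<^sub>M count_space (mspace M))"
      by (rule sets_pair_measure_cong) (simp_all add: sets_metric_borel_finite[OF fin])
    then show ?thesis
      unfolding pair_measure_count_space[OF fin fin] by simp
  qed
  show ?thesis
    unfolding transport_dist_def
  proof (rule cINF_greatest)
    interpret P: pair_prob_space \<mu> \<nu> ..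
    have distr_snd: "distr (\<mu> \<Otimes>\<^sub>M \<nu>) \<nu> snd = \<nu>"
    proof (rule measure_eqI)
      fix A assume "A \<in> sets (distr (\<mu> \<Otimes>\<^sub>M \<nu>) \<nu> snd)"
      then have A: "A \<in> sets \<nu>" by simp
      then have "snd -` A \<inter> space (\<mu> \<Otimes>\<^sub>M \<nu>) = space \<mu> \<times> A"
        using sets.sets_into_space[OF A] by (auto simp: space_pair_measure)
      then show "emeasure (distr (\<mu> \<Otimes>\<^sub>M \<nu>) \<nu> snd) A = emeasure \<nu> A"
        using A by (simp add: emeasure_distr \<nu>.emeasure_pair_measure_Times \<mu>.emeasure_space_1)
    qed simp
    have "distr (\<mu> \<Otimes>\<^sub>M \<nu>) ?B fst = distr (\<mu> \<Otimes>\<^sub>M \<nu>) \<mu> fst"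
      "distr (\<mu> \<Otimes>\<^sub>M \<nu>) ?B snd = distr (\<mu> \<Otimes>\<^sub>M \<nu>) \<nu> snd"
      by (intro distr_cong; simp add: sets)+
    then have "\<mu> \<Otimes>\<^sub>M \<nu> \<in> couplings M \<mu> \<nu>"
      unfolding couplings_def
      using \<nu>.distr_pair_fst[of \<mu>] distr_snd P.prob_space_axioms
        sets_pair_measure_cong[OF sets]
      by (simp add: space_prob_algebra)
    then show "couplings M \<mu> \<nu> \<noteq> {}"
      by blast
  next
    fix \<kappa> assume \<kappa>: "\<kappa> \<in> couplings M \<mu> \<nu>"
    then have K: "prob_space \<kappa>" "sets \<kappa> = sets (?B \<Otimes>\<^sub>M ?B)"
      "distr \<kappa> ?B fst = \<mu>" "distr \<kappa> ?B snd = \<nu>"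
      by (auto simp: couplings_def space_prob_algebra)
    interpret \<kappa>: prob_space \<kappa> by fact
    have sp: "space \<kappa> = mspace M \<times> mspace M"
      using sets_eq_imp_space_eq[OF K(2)] by (simp add: space_pair_measure)
    have int: "integrable \<kappa> h" for h :: "_ \<Rightarrow> real"
      by (rule integrable_Pow_finite[OF _ _ finite_cartesian_product[OF fin fin]])
         (simp_all add: \<kappa>.finite_measure_axioms K(2) setsBB)
    have meas: "fst \<in> \<kappa> \<rightarrow>\<^sub>M ?B" "snd \<in> \<kappa> \<rightarrow>\<^sub>M ?B"
      by (simp_all add: measurable_cong_sets[OF K(2) refl])
    have f_meas: "f \<in> borel_measurable ?B"
      by (rule borel_measurable_Pow[OF sets_metric_borel_finite[OF fin]])
    have "(\<integral>x. f x \<partial>\<mu>) - (\<integral>x. f x \<partial>\<nu>) = (\<integral>z. f (fst z) \<partial>\<kappa>) - (\<integral>z. f (snd z) \<partial>\<kappa>)"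
      by (simp add: K(3,4)[symmetric] integral_distr[OF meas(1) f_meas] integral_distr[OF meas(2) f_meas])
    also have "\<dots> = (\<integral>z. f (fst z) - f (snd z) \<partial>\<kappa>)"
      by (simp add: int)
    also have "\<dots> \<le> (\<integral>z. mdist M (fst z) (snd z) \<partial>\<kappa>)"
      using f int by (intro integral_mono) (auto simp: sp lipschitz1_def abs_le_iff)
    finally show "(\<integral>x. f x \<partial>\<mu>) - (\<integral>x. f x \<partial>\<nu>) \<le> (\<integral>z. mdist M (fst z) (snd z) \<partial>\<kappa>)" .
  qed
qed

text \<open>
  By \<open>ln (1 + h) \<le> h\<close>, the entropy of the perturbation \<open>1 + h\<close> is at most its
  \<open>\<chi>\<^sup>2\<close>-divergence.
\<close>

lemma relative_entropy_density_le:
  fixes h :: "'a \<Rightarrow> real"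
  assumes \<nu>: "prob_space \<nu>" "sets \<nu> = Pow A" "finite A"
    and h: "\<And>x. x \<in> A \<Longrightarrow> -1 < h x" "(\<integral>x. h x \<partial>\<nu>) = 0"
  defines "\<mu> \<equiv> density \<nu> (\<lambda>x. ennreal (1 + h x))"
  obtains D where "prob_space \<mu>" "relative_entropy \<mu> \<nu> = ereal D" "D \<le> (\<integral>x. (h x)\<^sup>2 \<partial>\<nu>)"
proof -
  interpret \<nu>: prob_space \<nu> by fact
  have sp: "space \<nu> = A"
    using sets_eq_imp_space_eq[of \<nu> "count_space A"] \<nu>(2) by simp
  have int: "integrable \<nu> f" for f :: "_ \<Rightarrow> real"
    by (rule integrable_Pow_finite[OF \<nu>.finite_measure_axioms \<nu>(2,3)])
  have meas: "f \<in> borel_measurable \<nu>" for f :: "_ \<Rightarrow> real"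
    by (rule borel_measurable_Pow[OF \<nu>(2)])
  have nn: "AE x in \<nu>. 0 \<le> 1 + h x"
    by (rule AE_I2) (use h(1) sp in force)
  have "emeasure \<mu> (space \<mu>) = (\<integral>\<^sup>+ x. ennreal (1 + h x) \<partial>\<nu>)"
    unfolding \<mu>_def by (subst emeasure_density) (auto intro!: nn_integral_cong measurable_compose[OF meas measurable_ennreal])
  also have "\<dots> = ennreal (\<integral>x. 1 + h x \<partial>\<nu>)"
    by (rule nn_integral_eq_integral[OF int nn])
  also have "\<dots> = 1"
    using h(2) \<nu>.prob_space by (simp add: int)
  finally have \<mu>: "prob_space \<mu>"
    by (rule prob_spaceI)
  then interpret \<mu>: prob_space \<mu> .
  have "integrable \<mu> (entropy_density (exp 1) \<nu> \<mu>)"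
    by (rule integrable_Pow_finite[OF \<mu>.finite_measure_axioms _ \<nu>(3)]) (simp add: \<mu>_def \<nu>(2))
  moreover have "absolutely_continuous \<nu> \<mu>"
    unfolding \<mu>_def by (intro absolutely_continuousI_density measurable_compose[OF meas measurable_ennreal])
  ultimately have "relative_entropy \<mu> \<nu> = ereal (KL_divergence (exp 1) \<nu> \<mu>)"
    by (simp add: relative_entropy_def)
  moreover have "KL_divergence (exp 1) \<nu> \<mu> \<le> (\<integral>x. (h x)\<^sup>2 \<partial>\<nu>)"
  proof -
    have "KL_divergence (exp 1) \<nu> \<mu> = (\<integral>x. (1 + h x) * log (exp 1) (1 + h x) \<partial>\<nu>)"
      unfolding \<mu>_def by (rule \<nu>.KL_density) (simp_all add: meas nn)
    also have "\<dots> \<le> (\<integral>x. h x + (h x)\<^sup>2 \<partial>\<nu>)"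
    proof (rule integral_mono)
      fix x assume "x \<in> space \<nu>"
      then have "-1 < h x"
        using h(1) sp by simp
      then have "(1 + h x) * ln (1 + h x) \<le> (1 + h x) * h x"
        by (intro mult_left_mono ln_add_one_self_le_self2) auto
      then show "(1 + h x) * log (exp 1) (1 + h x) \<le> h x + (h x)\<^sup>2"
        by (simp add: log_def algebra_simps power2_eq_square)
    qed (simp_all add: int)
    also have "\<dots> = (\<integral>x. (h x)\<^sup>2 \<partial>\<nu>)"
      by (simp add: int h(2))
    finally show ?thesis .
  qed
  ultimately show thesis
    using that \<mu> by blast
qed

context
  fixes V :: "'v set" and M :: "'a metric" and C :: real and \<nu> :: "('v \<Rightarrow> 'a) measure"
    and f :: "('v \<Rightarrow> 'a) \<Rightarrow> real"
  assumes V: "finite V" "V \<noteq> {}" and finM: "finite (mspace M)"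
    and \<nu>: "\<nu> \<in> Prob (hamming_metric V M)" and C: "0 \<le> C"
    and f: "lipschitz1 (hamming_metric V M) f" "(\<integral>x. f x \<partial>\<nu>) = 0"
begin

lemma finite_hamming: "finite (mspace (hamming_metric V M))"
  using V finM by (simp add: finite_PiE)

text \<open>
  The bound is tested on the measure with density \<open>1 + f\<close>: its distance to \<open>\<nu>\<close> is at least the
  variance of \<open>f\<close>, and its entropy is at most that variance.
\<close>

lemma variance_le_if_transport_entropy_bound:
  assumes small: "\<And>x. x \<in> mspace (hamming_metric V M) \<Longrightarrow> \<bar>f x\<bar> < 1"
    and bound: "transport_entropy_bound V M C \<nu>"
  shows "(real (card V))\<^sup>2 * (\<integral>x. (f x)\<^sup>2 \<partial>\<nu>) \<le> C\<^sup>2"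
proof -
  let ?H = "hamming_metric V M" and ?\<mu> = "density \<nu> (\<lambda>x. ennreal (1 + f x))"
  define n where "n = real (card V)"
  define s where "s = (\<integral>x. (f x)\<^sup>2 \<partial>\<nu>)"
  have n: "n > 0"
    using V by (simp add: n_def card_gt_0_iff)
  have s: "s \<ge> 0"
    by (simp add: s_def)
  have \<nu>': "prob_space \<nu>" "sets \<nu> = Pow (mspace ?H)"
    using \<nu> in_Prob_finite_iff[OF finite_hamming] by auto
  interpret prob_space \<nu> by fact
  have sp: "space \<nu> = mspace ?H"
    using sets_eq_imp_space_eq[of \<nu> "count_space (mspace ?H)"] \<nu>'(2) by simp
  have small': "-1 < f x" if "x \<in> mspace ?H" for x
    using small[OF that] by linarith
  obtain D where D: "prob_space ?\<mu>" "relative_entropy ?\<mu> \<nu> = ereal D" "D \<le> s"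
    using relative_entropy_density_le[OF \<nu>' finite_hamming small' f(2)] unfolding s_def by blast
  have \<mu>: "?\<mu> \<in> Prob ?H"
    using D(1) \<nu>' in_Prob_finite_iff[OF finite_hamming] by simp
  have int: "integrable \<nu> g" for g :: "_ \<Rightarrow> real"
    by (rule integrable_Pow_finite[OF finite_measure_axioms \<nu>'(2) finite_hamming])
  have meas: "g \<in> borel_measurable \<nu>" for g :: "_ \<Rightarrow> real"
    by (rule borel_measurable_Pow[OF \<nu>'(2)])
  have "(\<integral>x. f x \<partial>?\<mu>) = (\<integral>x. (1 + f x) * f x \<partial>\<nu>)"
  proof (rule integral_real_density)
    show "AE x in \<nu>. 0 \<le> 1 + f x"
      by (rule AE_I2) (use small' sp in force)
  qed (rule meas)+
  also have "\<dots> = s"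
    by (simp add: algebra_simps int f(2) s_def power2_eq_square)
  finally have "s \<le> transport_dist ?H ?\<mu> \<nu>"
    using integral_diff_le_transport_dist[OF finite_hamming \<mu> \<nu> f(1)] f(2) by simp
  also have "\<dots> \<le> C / n * sqrt (D / 2)"
    using bound \<mu> D(2) unfolding transport_entropy_bound_def n_def by blast
  also have "\<dots> \<le> C / n * sqrt s"
    using D(3) s n C by (intro mult_left_mono real_sqrt_le_mono) auto
  finally have "n * s \<le> C * sqrt s"
    using n by (simp add: field_simps)
  then have "(n * sqrt s) * sqrt s \<le> C * sqrt s"
    using s by (simp add: mult.assoc)
  then have "n * sqrt s \<le> C"
    using s C by (cases "s = 0") (auto simp: mult_le_cancel_right)
  then have "(n * sqrt s)\<^sup>2 \<le> C\<^sup>2"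
    using n s by (intro power_mono) auto
  then show ?thesis
    using s unfolding n_def s_def by (simp add: power_mult_distrib)
qed

text \<open>
  The two sides agree to first order at \<open>t = 0\<close>, so their quadratic terms are comparable. Averaging
  the bounds for \<open>t\<close> and \<open>- t\<close> removes the odd part of the exponential; a single small \<open>t\<close> then
  suffices.
\<close>

lemma variance_le_if_exponential_moment_bound:
  assumes bound: "exponential_moment_bound V M C \<nu>"
  shows "(real (card V))\<^sup>2 * (\<integral>x. (f x)\<^sup>2 \<partial>\<nu>) \<le> C\<^sup>2"
proof -
  define X where "X x = real (card V) * f x" for x
  define s where "s = (\<integral>x. (X x)\<^sup>2 \<partial>\<nu>)"
  \<comment> \<open>Small enough that the exponent \<open>C\<^sup>2 t\<^sup>2 / 8\<close> is at most 1, where \<open>exp s \<le> 1 + 2 s\<close>.\<close>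
  define t where "t = 1 / (1 + C)"
  have t: "0 < t" "C * t \<le> 1"
    using C by (auto simp: t_def field_simps)
  have \<nu>': "prob_space \<nu>" "sets \<nu> = Pow (mspace (hamming_metric V M))"
    using \<nu> in_Prob_finite_iff[OF finite_hamming] by auto
  interpret prob_space \<nu> by fact
  have int: "integrable \<nu> g" for g :: "_ \<Rightarrow> real"
    by (rule integrable_Pow_finite[OF finite_measure_axioms \<nu>'(2) finite_hamming])
  have quadratic: "2 + x\<^sup>2 / 2 \<le> exp x + exp (- x)" for x :: real
  proof -
    have "2 + x\<^sup>2 / 2 \<le> exp \<bar>x\<bar> + exp (- \<bar>x\<bar>)"
      using exp_lower_Taylor_quadratic[of "\<bar>x\<bar>"] exp_ge_add_one_self[of "- \<bar>x\<bar>"] by simp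
    also have "\<dots> = exp x + exp (- x)"
      by (cases "x \<ge> 0") auto
    finally show ?thesis .
  qed
  have mom: "(\<integral>x. exp (r * X x) \<partial>\<nu>) \<le> exp (C\<^sup>2 * r\<^sup>2 / 8)" for r
  proof -
    have "exp (r * X x) = exp (real (card V) * r * f x)" for x
      by (simp add: X_def mult_ac)
    then show ?thesis
      using bound f by (simp only: exponential_moment_bound_def)
  qed
  have "2 + t\<^sup>2 * s / 2 = (\<integral>x. 2 + (t * X x)\<^sup>2 / 2 \<partial>\<nu>)"
    by (simp add: int s_def power_mult_distrib prob_space)
  also have "\<dots> \<le> (\<integral>x. exp (t * X x) + exp (- (t * X x)) \<partial>\<nu>)"
    by (intro integral_mono int quadratic)
  also have "\<dots> \<le> 2 * exp (C\<^sup>2 * t\<^sup>2 / 8)"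
    using mom[of t] mom[of "-t"] by (simp add: int)
  also have "exp (C\<^sup>2 * t\<^sup>2 / 8) \<le> 1 + 2 * (C\<^sup>2 * t\<^sup>2 / 8)"
  proof -
    have "(C * t)\<^sup>2 \<le> 1"
      using t C by (intro power_le_one) auto
    then have le: "C\<^sup>2 * t\<^sup>2 / 8 \<le> 1"
      by (simp add: power_mult_distrib)
    then have "exp (C\<^sup>2 * t\<^sup>2 / 8) \<le> 1 + C\<^sup>2 * t\<^sup>2 / 8 + (C\<^sup>2 * t\<^sup>2 / 8)\<^sup>2"
      by (intro exp_bound) auto
    also have "(C\<^sup>2 * t\<^sup>2 / 8)\<^sup>2 \<le> C\<^sup>2 * t\<^sup>2 / 8"
      using le unfolding power2_eq_square[of "C\<^sup>2 * t\<^sup>2 / 8"] by (intro mult_left_le) auto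
    finally show ?thesis by simp
  qed
  finally have "t\<^sup>2 * s \<le> t\<^sup>2 * C\<^sup>2"
    by (simp add: mult.commute)
  then have "s \<le> C\<^sup>2"
    using t(1) by simp
  then show ?thesis
    unfolding s_def X_def by (simp add: power_mult_distrib int)
qed

end


section \<open>The Ising model as a Lipschitz Markov measure\<close>

definition sign_metric :: "real metric" where
  "sign_metric = metric (signs, \<lambda>x y. \<bar>x - y\<bar> / 2)"

lemma Metric_space_signs: "Metric_space signs (\<lambda>x y. \<bar>x - y\<bar> / 2)"
  by standard auto

lemma mspace_sign_metric [simp]: "mspace sign_metric = signs"
  unfolding sign_metric_def by (rule Metric_space.mspace_metric[OF Metric_space_signs])

lemma mdist_sign_metric [simp]: "mdist sign_metric x y = \<bar>x - y\<bar> / 2"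
  unfolding sign_metric_def by (simp add: Metric_space.mdist_metric[OF Metric_space_signs])

definition sign_kernel :: "real \<Rightarrow> real \<Rightarrow> real measure" where
  "sign_kernel b x = point_measure signs (\<lambda>s. ennreal ((1 + b * x * s) / 2))"

lemma sign_kernel_nonneg:
  fixes b :: real
  shows "0 \<le> b \<Longrightarrow> b < 1 \<Longrightarrow> x \<in> signs \<Longrightarrow> s \<in> signs \<Longrightarrow> 0 \<le> (1 + b * x * s) / 2"
  by auto

lemma finite_sign_metric: "finite (mspace sign_metric)"
  by simp

lemma sign_kernel_in_Prob:
  assumes "0 \<le> b" "b < 1" "x \<in> signs"
  shows "sign_kernel b x \<in> Prob sign_metric"
proof -
  have "(\<Sum>s\<in>signs. ennreal ((1 + b * x * s) / 2)) = ennreal (\<Sum>s\<in>signs. (1 + b * x * s) / 2)"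
    using sign_kernel_nonneg[OF assms] by (intro sum_ennreal)
  also have "(\<Sum>s\<in>signs. (1 + b * x * s) / 2) = 1"
    by (simp add: field_simps)
  finally have "prob_space (sign_kernel b x)"
    unfolding sign_kernel_def by (intro prob_space_point_measure) auto
  then show ?thesis
    by (simp add: in_Prob_finite_iff[OF finite_sign_metric] sign_kernel_def sets_point_measure)
qed

lemma distr_point_measure_eq:
  fixes c :: "'a \<Rightarrow> real"
  assumes "finite A" "finite B" "sets N = Pow B" "h \<in> A \<rightarrow> B"
    and "\<And>a. a \<in> A \<Longrightarrow> 0 \<le> c a" "\<And>y. y \<in> B \<Longrightarrow> (\<Sum>a | a \<in> A \<and> h a = y. c a) = p y"
  shows "distr (point_measure A (\<lambda>a. ennreal (c a))) N h = point_measure B (\<lambda>y. ennreal (p y))"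
proof (rule measure_eqI_finite)
  fix y assume y: "y \<in> B"
  have spN: "space N = B"
    using sets_eq_imp_space_eq[of N "count_space B"] assms(3) by simp
  have "h \<in> point_measure A (\<lambda>a. ennreal (c a)) \<rightarrow>\<^sub>M N"
    using assms(4) spN by simp
  then have "emeasure (distr (point_measure A (\<lambda>a. ennreal (c a))) N h) {y}
      = emeasure (point_measure A (\<lambda>a. ennreal (c a))) {a \<in> A. h a = y}"
    using y assms(3)
    by (subst emeasure_distr) (auto simp: space_point_measure intro!: arg_cong2[where f = emeasure])
  also have "\<dots> = (\<Sum>a | a \<in> A \<and> h a = y. ennreal (c a))"
    using assms(1) by (intro emeasure_point_measure_finite) auto
  also have "\<dots> = ennreal (p y)"
    using assms(5) assms(6)[OF y] by (subst sum_ennreal) auto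
  finally show "emeasure (distr (point_measure A (\<lambda>a. ennreal (c a))) N h) {y}
      = emeasure (point_measure B (\<lambda>y. ennreal (p y))) {y}"
    using y assms(2) by (simp add: emeasure_point_measure_finite)
qed (simp_all add: assms sets_point_measure)

text \<open>
  The coupling either keeps both starting points, with probability \<open>b\<close>, or moves both to the same
  uniform sign. Only the first event costs anything.
\<close>

lemma lipschitz_sign_kernel:
  assumes b: "0 \<le> b" "b < 1"
  shows "lipschitz_kernel sign_metric b (sign_kernel b)"
  unfolding lipschitz_kernel_def
proof (intro ballI)
  fix x y assume "x \<in> mspace sign_metric" "y \<in> mspace sign_metric"
  then have xy: "x \<in> signs" "y \<in> signs"
    by simp_all
  define c :: "real \<times> real \<Rightarrow> real" where
    "c z = (if z = (x, y) then b else 0) + (if fst z = snd z then (1 - b) / 2 else 0)" for z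
  define \<kappa> where "\<kappa> = point_measure (signs \<times> signs) (\<lambda>z. ennreal (c z))"
  let ?B = "metric_borel sign_metric"
  have setsB: "sets ?B = Pow signs"
    using sets_metric_borel_finite[OF finite_sign_metric] by simp
  have c: "0 \<le> c z" for z
    using b by (simp add: c_def)
  have marginals: "{z. z \<in> signs \<times> signs \<and> fst z = s} = {(s, -1), (s, 1)}"
    "{z. z \<in> signs \<times> signs \<and> snd z = s} = {(-1, s), (1, s)}" if "s \<in> signs" for s
    using that by auto
  have "(\<Sum>z | z \<in> signs \<times> signs \<and> fst z = s. c z) = (1 + b * x * s) / 2" if "s \<in> signs" for s
    unfolding marginals[OF that] using that xy by (auto simp: c_def field_simps)
  then have fst: "distr \<kappa> ?B fst = sign_kernel b x"
    unfolding \<kappa>_def sign_kernel_def using c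
    by (intro distr_point_measure_eq[OF _ _ setsB]) auto
  have "(\<Sum>z | z \<in> signs \<times> signs \<and> snd z = s. c z) = (1 + b * y * s) / 2" if "s \<in> signs" for s
    unfolding marginals[OF that] using that xy by (auto simp: c_def field_simps)
  then have snd: "distr \<kappa> ?B snd = sign_kernel b y"
    unfolding \<kappa>_def sign_kernel_def using c
    by (intro distr_point_measure_eq[OF _ _ setsB]) auto
  have "sets (?B \<Otimes>\<^sub>M ?B) = sets (count_space signs \<Otimes>\<^sub>M count_space signs)"
    by (rule sets_pair_measure_cong) (simp_all add: setsB)
  also have "\<dots> = Pow (signs \<times> signs)"
    by (subst pair_measure_count_space) auto
  finally have sets\<kappa>: "sets \<kappa> = sets (?B \<Otimes>\<^sub>M ?B)"
    by (simp add: \<kappa>_def sets_point_measure)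
  have "prob_space (distr \<kappa> ?B fst)"
    unfolding fst using sign_kernel_in_Prob[OF b xy(1)] in_Prob_finite_iff[OF finite_sign_metric]
    by blast
  then have "prob_space \<kappa>"
    by (rule prob_space_distrD[rotated]) (simp add: measurable_cong_sets[OF sets\<kappa> refl])
  then have "\<kappa> \<in> couplings sign_metric (sign_kernel b x) (sign_kernel b y)"
    using fst snd sets\<kappa> by (simp add: couplings_def space_prob_algebra)
  then have "transport_dist sign_metric (sign_kernel b x) (sign_kernel b y)
      \<le> (\<integral>z. mdist sign_metric (fst z) (snd z) \<partial>\<kappa>)"
    unfolding transport_dist_def by (intro cINF_lower bdd_belowI2[where m = 0]) auto
  also have "\<dots> = (\<Sum>z\<in>signs \<times> signs. c z * (\<bar>fst z - snd z\<bar> / 2))"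
    unfolding \<kappa>_def using c by (subst lebesgue_integral_point_measure_finite) auto
  also have "\<dots> = (\<Sum>z\<in>signs \<times> signs. if z = (x, y) then b * (\<bar>x - y\<bar> / 2) else 0)"
    by (intro sum.cong refl) (auto simp: c_def)
  also have "\<dots> = b * mdist sign_metric x y"
    using xy by (subst sum.delta) auto
  finally show "transport_dist sign_metric (sign_kernel b x) (sign_kernel b y)
      \<le> b * mdist sign_metric x y" .
qed

context rooted_tree
begin

definition ising_measure :: "real \<Rightarrow> ('v \<Rightarrow> real) measure" where
  "ising_measure b = point_measure configs (\<lambda>y. ennreal (ising_weight b y))"

lemma ising_factor_nonneg:
  assumes "0 \<le> b" "b < 1" "y \<in> configs" "v \<in> V - {\<rho>}"
  shows "0 \<le> (1 + b * y (parent V E \<rho> v) * y v) / 2"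
proof (rule sign_kernel_nonneg)
  show "y (parent V E \<rho> v) \<in> signs" "y v \<in> signs"
    using assms(3,4) tree_path_parent(1)[of v] by (auto simp del: insert_iff)
qed fact+

lemma ising_weight_nonneg:
  assumes "0 \<le> b" "b < 1" "y \<in> configs"
  shows "0 \<le> ising_weight b y"
  unfolding ising_weight_def
  using ising_factor_nonneg[OF assms] by (intro mult_nonneg_nonneg prod_nonneg) auto

lemma integral_ising_measure:
  fixes h :: "('v \<Rightarrow> real) \<Rightarrow> real"
  assumes "0 \<le> b" "b < 1"
  shows "(\<integral>y. h y \<partial>ising_measure b) = (\<Sum>y\<in>configs. ising_weight b y * h y)"
  unfolding ising_measure_def
  using ising_weight_nonneg[OF assms] finite_configs
  by (subst lebesgue_integral_point_measure_finite) auto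

lemma finite_hamming_configs: "finite (mspace (hamming_metric V sign_metric))"
  using finite_configs finite_V by simp

lemma ising_measure_in_Prob:
  assumes "0 \<le> b" "b < 1"
  shows "ising_measure b \<in> Prob (hamming_metric V sign_metric)"
proof -
  have "(\<Sum>y\<in>configs. ennreal (ising_weight b y)) = 1"
    using ising_weight_nonneg[OF assms] by (simp add: sum_ennreal sum_ising_weight)
  then have "prob_space (ising_measure b)"
    unfolding ising_measure_def using finite_configs by (intro prob_space_point_measure) auto
  then show ?thesis
    using finite_V
    by (simp add: in_Prob_finite_iff[OF finite_hamming_configs] ising_measure_def sets_point_measure)
qed

lemma lipschitz_markov_ising_measure:
  assumes b: "0 \<le> b" "b < 1"
  shows "lipschitz_markov_measure V E \<rho> b sign_metric (ising_measure b)"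
  unfolding lipschitz_markov_measure_def
proof (intro exI conjI ballI)
  \<comment> \<open>For \<open>b = 0\<close> the kernel ignores its argument and is uniform, which is the law of the root.\<close>
  show "markov_measure V E \<rho> sign_metric (sign_kernel 0 1) (\<lambda>_. sign_kernel b) (ising_measure b)"
    unfolding markov_measure_def
  proof (intro conjI ballI)
    show "sign_kernel 0 1 \<in> Prob sign_metric"
      by (rule sign_kernel_in_Prob) auto
    show "sign_kernel b \<in> metric_borel sign_metric \<rightarrow>\<^sub>M prob_algebra (metric_borel sign_metric)"
    proof (rule measurableI)
      show "sign_kernel b x \<in> space (prob_algebra (metric_borel sign_metric))"
        if "x \<in> space (metric_borel sign_metric)" for x
        using that sign_kernel_in_Prob[OF b, of x] by (simp add: Prob_def)
    qed (auto simp: sets_metric_borel_finite[OF finite_sign_metric])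
    show "ising_measure b \<in> Prob (hamming_metric V sign_metric)"
      by (rule ising_measure_in_Prob[OF b])
    fix A assume "A \<in> sets (metric_borel (hamming_metric V sign_metric))"
    then have A: "A \<subseteq> configs"
      using finite_V by (simp add: sets_metric_borel_finite[OF finite_hamming_configs])
    have "(\<integral>\<^sup>+ x. level_integral V E \<rho> (\<lambda>_. sign_kernel b) (indicator A) (depth V E \<rho>) 1
              (\<lambda>v\<in>{\<rho>}. x) \<partial>sign_kernel 0 1)
        = (\<Sum>y\<in>configs. ennreal ((1 + 0 * 1 * y \<rho>) / 2)
            * (\<Prod>v\<in>V - {\<rho>}. ennreal ((1 + b * y (parent V E \<rho> v) * y v) / 2)) * indicator A y)"
      using nn_integral_level_integral_point_measure
        [where S = signs and g = "\<lambda>x s. (1 + b * x * s) / 2" and F = "indicator A"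
          and p = "\<lambda>s. (1 + 0 * 1 * s) / 2"]
      unfolding sign_kernel_def[abs_def] by blast
    also have "\<dots> = (\<Sum>y\<in>configs. ennreal (ising_weight b y) * indicator A y)"
    proof (rule sum.cong[OF refl])
      fix y assume y: "y \<in> configs"
      have "ennreal (ising_weight b y)
          = ennreal (1 / 2) * ennreal (\<Prod>v\<in>V - {\<rho>}. (1 + b * y (parent V E \<rho> v) * y v) / 2)"
        unfolding ising_weight_def
        using ising_factor_nonneg[OF b y] by (intro ennreal_mult prod_nonneg) auto
      also have "ennreal (\<Prod>v\<in>V - {\<rho>}. (1 + b * y (parent V E \<rho> v) * y v) / 2)
          = (\<Prod>v\<in>V - {\<rho>}. ennreal ((1 + b * y (parent V E \<rho> v) * y v) / 2))"
        using ising_factor_nonneg[OF b y] by (rule prod_ennreal[symmetric])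
      finally show "ennreal ((1 + 0 * 1 * y \<rho>) / 2)
            * (\<Prod>v\<in>V - {\<rho>}. ennreal ((1 + b * y (parent V E \<rho> v) * y v) / 2)) * indicator A y
          = ennreal (ising_weight b y) * indicator A y"
        by simp
    qed
    also have "\<dots> = (\<Sum>y\<in>A. ennreal (ising_weight b y))"
      using A finite_configs
      by (intro sum.mono_neutral_cong_right) (auto simp: indicator_def)
    also have "\<dots> = emeasure (ising_measure b) A"
      unfolding ising_measure_def using A finite_configs
      by (intro emeasure_point_measure_finite[symmetric])
    finally show "emeasure (ising_measure b) A
        = (\<integral>\<^sup>+ x. level_integral V E \<rho> (\<lambda>_. sign_kernel b) (indicator A) (depth V E \<rho>) 1
              (\<lambda>v\<in>{\<rho>}. x) \<partial>sign_kernel 0 1)"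
      by simp
  qed
qed (rule lipschitz_sign_kernel[OF b])

definition magnetization :: "('v \<Rightarrow> real) \<Rightarrow> real" where
  "magnetization y = (\<Sum>v\<in>V. y v) / (2 * real (card V))"

lemma lipschitz_magnetization: "lipschitz1 (hamming_metric V sign_metric) magnetization"
  unfolding lipschitz1_def
proof (intro ballI)
  fix x y
  have "\<bar>magnetization x - magnetization y\<bar> = \<bar>\<Sum>v\<in>V. x v - y v\<bar> / (2 * real (card V))"
    by (simp add: magnetization_def sum_subtractf flip: diff_divide_distrib)
  also have "\<dots> \<le> (\<Sum>v\<in>V. \<bar>x v - y v\<bar>) / (2 * real (card V))"
    by (intro divide_right_mono sum_abs) auto
  also have "\<dots> = mdist (hamming_metric V sign_metric) x y"
    using finite_V by (simp flip: sum_divide_distrib)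
  finally show "\<bar>magnetization x - magnetization y\<bar> \<le> mdist (hamming_metric V sign_metric) x y" .
qed

lemma abs_magnetization_less:
  assumes "y \<in> configs"
  shows "\<bar>magnetization y\<bar> < 1"
proof -
  have "\<bar>\<Sum>v\<in>V. y v\<bar> \<le> (\<Sum>v\<in>V. \<bar>y v\<bar>)"
    by (rule sum_abs)
  also have "\<dots> = (\<Sum>v\<in>V. 1)"
    by (rule sum.cong) (use assms in \<open>auto dest!: PiE_mem\<close>)
  finally show ?thesis
    using card_V_pos by (simp add: magnetization_def field_simps)
qed

lemma integral_magnetization:
  assumes b: "0 \<le> b" "b < 1"
  shows "(\<integral>y. magnetization y \<partial>ising_measure b) = 0"
proof -
  have "(\<integral>y. magnetization y \<partial>ising_measure b)
      = (\<Sum>y\<in>configs. \<Sum>v\<in>V. ising_weight b y * y v) / (2 * real (card V))"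
    by (simp add: integral_ising_measure[OF b] magnetization_def sum_distrib_left sum_divide_distrib)
  also have "(\<Sum>y\<in>configs. \<Sum>v\<in>V. ising_weight b y * y v) = 0"
    by (subst sum.swap) (simp add: ising_mean)
  finally show ?thesis by simp
qed

lemma integral_magnetization_square:
  assumes b: "0 \<le> b" "b < 1"
  shows "(real (card V))\<^sup>2 * (\<integral>y. (magnetization y)\<^sup>2 \<partial>ising_measure b)
    = (\<Sum>v\<in>V. \<Sum>w\<in>V. b ^ card (sym_diff (anc v) (anc w))) / 4"
proof -
  have "(real (card V))\<^sup>2 * (magnetization y)\<^sup>2 = (\<Sum>v\<in>V. \<Sum>w\<in>V. y v * y w) / 4" for y
  proof -
    have "(real (card V))\<^sup>2 * (magnetization y)\<^sup>2 = (\<Sum>v\<in>V. y v)\<^sup>2 / 4"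
      using card_V_pos by (simp add: magnetization_def power_divide power_mult_distrib)
    then show ?thesis
      by (simp add: power2_eq_square sum_product)
  qed
  then have "(real (card V))\<^sup>2 * (\<integral>y. (magnetization y)\<^sup>2 \<partial>ising_measure b)
      = (\<Sum>y\<in>configs. \<Sum>v\<in>V. \<Sum>w\<in>V. ising_weight b y * (y v * y w)) / 4"
    by (simp add: integral_ising_measure[OF b] sum_distrib_left sum_divide_distrib
        mult.left_commute[of "(real (card V))\<^sup>2"])
  also have "(\<Sum>y\<in>configs. \<Sum>v\<in>V. \<Sum>w\<in>V. ising_weight b y * (y v * y w))
      = (\<Sum>v\<in>V. \<Sum>w\<in>V. \<Sum>y\<in>configs. ising_weight b y * (y v * y w))"
    by (subst sum.swap, rule sum.cong[OF refl], rule sum.swap)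
  also have "\<dots> = (\<Sum>v\<in>V. \<Sum>w\<in>V. b ^ card (sym_diff (anc v) (anc w)))"
    by (simp add: ising_covariance)
  finally show ?thesis .
qed

end

theorem theorem4:
  fixes V :: "'v set" and E :: "'v set set" and \<rho> :: 'v and b C :: real
  assumes "finite_rooted_tree V E \<rho>"
    and "0 \<le> b" and "b < 1"
    and "0 \<le> C"
    and "\<And>(M :: real metric) \<nu>.
           polish_metric M \<Longrightarrow>
           (\<forall>x\<in>mspace M. \<forall>y\<in>mspace M. mdist M x y \<le> 1) \<Longrightarrow>
           lipschitz_markov_measure V E \<rho> b M \<nu> \<Longrightarrow>
           exponential_moment_bound V M C \<nu> \<or> transport_entropy_bound V M C \<nu>"
  shows "C \<ge> desc_gen_norm V E \<rho> b * sqrt (1 - b\<^sup>2) / 2"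
proof -
  interpret rooted_tree V E \<rho>
    using assms(1) by (rule rooted_tree.intro)
  note b = assms(2,3)
  define \<Delta> where "\<Delta> = desc_gen_norm V E \<rho> b"
  have V: "finite V" "V \<noteq> {}"
    using finite_V root_in_V by auto
  have b2: "b\<^sup>2 \<le> 1"
    using b by (simp add: power_le_one)
  note context_facts = V finite_sign_metric ising_measure_in_Prob[OF b] assms(4)
    lipschitz_magnetization integral_magnetization[OF b]
  have "exponential_moment_bound V sign_metric C (ising_measure b)
      \<or> transport_entropy_bound V sign_metric C (ising_measure b)"
    by (rule assms(5))
       (auto simp: polish_metric_finite lipschitz_markov_ising_measure[OF b])
  then have "(real (card V))\<^sup>2 * (\<integral>y. (magnetization y)\<^sup>2 \<partial>ising_measure b) \<le> C\<^sup>2"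
  proof
    assume "exponential_moment_bound V sign_metric C (ising_measure b)"
    then show ?thesis
      by (rule variance_le_if_exponential_moment_bound[OF context_facts])
  next
    assume "transport_entropy_bound V sign_metric C (ising_measure b)"
    then show ?thesis
      using V(1) abs_magnetization_less
      by (intro variance_le_if_transport_entropy_bound[OF context_facts]) auto
  qed
  then have "(1 - b\<^sup>2) * \<Delta>\<^sup>2 \<le> 4 * C\<^sup>2"
    using desc_gen_norm_le[OF b] integral_magnetization_square[OF b] by (simp add: \<Delta>_def)
  then have "(\<Delta> * sqrt (1 - b\<^sup>2) / 2)\<^sup>2 \<le> C\<^sup>2"
    using b2 by (simp add: power_mult_distrib power_divide mult.commute)
  then show ?thesis
    unfolding \<Delta>_def using assms(4) by (rule power2_le_imp_le)
qed

end
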